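(* Let $T>0$, let $n\ge 1$ and $k\geq 2$ be integers, let $D\subset\mathbb{R}^n$ be open and bounded, and let $\varepsilon_0>0$. Consider the differential equation $$\dot x=\sum_{i=1}^k\varepsilon^iF_i(t,x)+\varepsilon^{k+1}R(t,x,\varepsilon),\qquad (t,x,\varepsilon)\in\mathbb{R}\times D\times[0,\varepsilon_0],$$ where $F_1,\dots,F_k:\mathbb{R}\times D\to\mathbb{R}^n$ and $R:\mathbb{R}\times D\times[0,\varepsilon_0]\to\mathbb{R}^n$ are smooth and $T$-periodic in $t$. Let $\mathbf f_i:D\to\mathbb{R}^n$ and $\mathbf g_i:D\to\mathbb{R}^n$, $i\in\{1,\dots,k\}$, be respectively its Melnikov function of order $i$ and its stroboscopic averaged function of order $i$. Let $\ell\in\{2,\dots,k\}$. If either $\mathbf f_1=\cdots=\mathbf f_{\ell-1}=0$ on $D$ or $\mathbf g_1=\cdots=\mathbf g_{\ell-1}=0$ on $D$, then $$\mathbf f_i=T\,\mathbf g_i\quad\text{for every } i\in\{1,\dots,2\ell-1\}\text{ with } i\le k,$$ and, provided $2\ell\le k$, for every $z\in D$, $$\mathbf g_{2\ell}(z)=\frac1T\left(\mathbf f_{2\ell}(z)-\frac12\,d\mathbf f_\ell(z)\cdot\mathbf f_\ell(z)\right),$$ or, equivalently, $$\mathbf f_{2\ell}(z)=T\,\mathbf g_{2\ell}(z)+\frac{T^2}{2}\,d\mathbf g_\ell(z)\cdot\mathbf g_\ell(z).$$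
   Context: Here "smooth" means $C^\infty$, and for a smooth map $\mathbf h:D\to\mathbb{R}^n$, $d\mathbf h(z)\cdot v$ denotes the derivative (Jacobian matrix) of $\mathbf h$ at $z$ applied to the vector $v\in\mathbb{R}^n$. Melnikov functions. For $z\in D$ and $\varepsilon\ge 0$ small, let $x(t,z,\varepsilon)$ be the solution of the differential equation with $x(0,z,\varepsilon)=z$; it is defined for $t\in[0,T]$ for $z$ in any given compact subset of $D$ and $\varepsilon$ sufficiently small. The Melnikov functions $\mathbf f_1,\dots,\mathbf f_k:D\to\mathbb{R}^n$ are the coefficients of the expansion of the time-$T$ map in $\varepsilon$: $$x(T,z,\varepsilon)=z+\sum_{i=1}^k\varepsilon^i\,\mathbf f_i(z)+O(\varepsilon^{k+1}),$$ uniformly for $z$ in compact subsets of $D$. Stroboscopic averaged functions. The functions $\mathbf g_1,\dots,\mathbf g_k:D\to\mathbb{R}^n$ are the (uniquely determined) smooth functions for which there exist smooth functions $u_1,\dots,u_k:\mathbb{R}\times D\to\mathbb{R}^n$, $T$-periodic in $t$ and satisfying the stroboscopic condition $u_i(0,z)=0$ for all $z\in D$, such that the near-identity change of variables $x=z+\sum_{i=1}^k\varepsilon^iu_i(t,z)$ transforms the differential equation into $$\dot z=\sum_{i=1}^k\varepsilon^i\,\mathbf g_i(z)+O(\varepsilon^{k+1}),$$ where the remainder is $T$-periodic in $t$ and the estimate is uniform for $t\in[0,T]$ and $z$ in compact subsets of $D$, as $\varepsilon\to0^+$. *)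

theory Defs
  imports "HOL-Analysis.Analysis"
begin

text \<open>
  Derivatives are taken within \<open>S\<close>: on open sets this is the usual notion, and on a product such as
  \<open>UNIV \<times> D \<times> {0..e}\<close> with \<open>D\<close> open and \<open>e > 0\<close>, where derivatives within \<open>S\<close> are still unique,
  it amounts to one-sided derivatives at the boundary values of the last variable.
\<close>

fun Ck_on :: "nat \<Rightarrow> ('a::euclidean_space \<Rightarrow> 'b::real_normed_vector) \<Rightarrow> 'a set \<Rightarrow> bool" where
  "Ck_on 0 f S \<longleftrightarrow> continuous_on S f"
| "Ck_on (Suc m) f S \<longleftrightarrow>
     (\<exists>f'. (\<forall>x\<in>S. (f has_derivative f' x) (at x within S)) \<and> (\<forall>v. Ck_on m (\<lambda>x. f' x v) S))"

definition smooth_on :: "('a::euclidean_space \<Rightarrow> 'b::real_normed_vector) \<Rightarrow> 'a set \<Rightarrow> bool" where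
  "smooth_on f S \<longleftrightarrow> (\<forall>m. Ck_on m f S)"

definition ode_rhs ::
  "nat \<Rightarrow> (nat \<Rightarrow> real \<Rightarrow> 'a \<Rightarrow> 'a) \<Rightarrow> (real \<Rightarrow> 'a \<Rightarrow> real \<Rightarrow> 'a) \<Rightarrow>
    real \<Rightarrow> 'a \<Rightarrow> real \<Rightarrow> 'a::euclidean_space" where
  "ode_rhs k F R t x \<epsilon> = (\<Sum>i=1..k. \<epsilon> ^ i *\<^sub>R F i t x) + \<epsilon> ^ (k + 1) *\<^sub>R R t x \<epsilon>"

definition ode_solution ::
  "(real \<Rightarrow> 'a \<Rightarrow> 'a) \<Rightarrow> 'a set \<Rightarrow> real \<Rightarrow> 'a \<Rightarrow> (real \<Rightarrow> 'a::euclidean_space) \<Rightarrow> bool" where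
  "ode_solution X D T z x \<longleftrightarrow> x 0 = z \<and>
     (\<forall>t\<in>{0..T}. x t \<in> D \<and> (x has_vector_derivative X t (x t)) (at t within {0..T}))"

text \<open>
  A solution on \<open>[0,T]\<close> through a given point is unique there (the right-hand side is smooth in
  \<open>x\<close>), so quantifying over all \<open>x\<close> below speaks about the value at \<open>T\<close> of the solution.
\<close>

definition melnikov_functions ::
  "real \<Rightarrow> 'a set \<Rightarrow> real \<Rightarrow> nat \<Rightarrow> (nat \<Rightarrow> real \<Rightarrow> 'a \<Rightarrow> 'a) \<Rightarrow> (real \<Rightarrow> 'a \<Rightarrow> real \<Rightarrow> 'a) \<Rightarrow>
    (nat \<Rightarrow> 'a \<Rightarrow> 'a::euclidean_space) \<Rightarrow> bool" where
  "melnikov_functions T D \<epsilon>0 k F R f \<longleftrightarrow>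
     (\<forall>K. compact K \<and> K \<subseteq> D \<longrightarrow>
       (\<exists>\<epsilon>1\<in>{0<..\<epsilon>0}. \<exists>C. \<forall>\<epsilon>\<in>{0..\<epsilon>1}. \<forall>z\<in>K.
          (\<exists>x. ode_solution (\<lambda>t x. ode_rhs k F R t x \<epsilon>) D T z x) \<and>
          (\<forall>x. ode_solution (\<lambda>t x. ode_rhs k F R t x \<epsilon>) D T z x \<longrightarrow>
             norm (x T - (z + (\<Sum>i=1..k. \<epsilon> ^ i *\<^sub>R f i z))) \<le> C * \<epsilon> ^ (k + 1))))"

definition near_identity ::
  "nat \<Rightarrow> (nat \<Rightarrow> real \<Rightarrow> 'a \<Rightarrow> 'a) \<Rightarrow> real \<Rightarrow> 'a \<Rightarrow> real \<Rightarrow> 'a::euclidean_space" where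
  "near_identity k u t z \<epsilon> = z + (\<Sum>i=1..k. \<epsilon> ^ i *\<^sub>R u i t z)"

text \<open>
  A change of variables \<open>x = U t z\<close> transforms \<open>x' = X t x\<close> into \<open>z' = Z t z\<close> at \<open>(t, z)\<close> if, for
  every curve \<open>\<zeta>\<close> passing through \<open>z\<close> at time \<open>t\<close> and differentiable there, \<open>s \<mapsto> U s (\<zeta> s)\<close>
  satisfies the first equation at time \<open>t\<close> exactly when \<open>\<zeta>\<close> satisfies the second.
\<close>

definition transforms_ode_at ::
  "(real \<Rightarrow> 'a \<Rightarrow> 'a) \<Rightarrow> (real \<Rightarrow> 'a \<Rightarrow> 'a) \<Rightarrow> (real \<Rightarrow> 'a \<Rightarrow> 'a) \<Rightarrow>
    real \<Rightarrow> 'a::euclidean_space \<Rightarrow> bool" where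
  "transforms_ode_at U X Z t z \<longleftrightarrow>
     (\<forall>\<zeta>. \<zeta> t = z \<and> \<zeta> differentiable (at t) \<longrightarrow>
        (((\<lambda>s. U s (\<zeta> s)) has_vector_derivative X t (U t z)) (at t) \<longleftrightarrow>
         (\<zeta> has_vector_derivative Z t z) (at t)))"

text \<open>\<open>r\<close> is the remainder \<open>O(\<epsilon>\<^bsup>k+1\<^esup>)\<close> of the transformed equation.\<close>

definition stroboscopic_averaged_functions ::
  "real \<Rightarrow> 'a set \<Rightarrow> real \<Rightarrow> nat \<Rightarrow> (nat \<Rightarrow> real \<Rightarrow> 'a \<Rightarrow> 'a) \<Rightarrow> (real \<Rightarrow> 'a \<Rightarrow> real \<Rightarrow> 'a) \<Rightarrow>
    (nat \<Rightarrow> 'a \<Rightarrow> 'a::euclidean_space) \<Rightarrow> bool" where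
  "stroboscopic_averaged_functions T D \<epsilon>0 k F R g \<longleftrightarrow>
     (\<forall>i\<in>{1..k}. smooth_on (g i) D) \<and>
     (\<exists>u r.
       (\<forall>i\<in>{1..k}. smooth_on (\<lambda>(t, z). u i t z) (UNIV \<times> D)
          \<and> (\<forall>t. \<forall>z\<in>D. u i (t + T) z = u i t z)
          \<and> (\<forall>z\<in>D. u i 0 z = 0)) \<and>
       (\<forall>t. \<forall>z\<in>D. \<forall>\<epsilon>\<in>{0..\<epsilon>0}. r (t + T) z \<epsilon> = r t z \<epsilon>) \<and>
       (\<forall>K. compact K \<and> K \<subseteq> D \<longrightarrow>
         (\<exists>\<epsilon>1\<in>{0<..\<epsilon>0}. \<exists>C. \<forall>\<epsilon>\<in>{0..\<epsilon>1}. \<forall>z\<in>K.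
            (\<forall>t. near_identity k u t z \<epsilon> \<in> D \<and>
               transforms_ode_at
                 (\<lambda>t z. near_identity k u t z \<epsilon>)
                 (\<lambda>t x. ode_rhs k F R t x \<epsilon>)
                 (\<lambda>t z. (\<Sum>i=1..k. \<epsilon> ^ i *\<^sub>R g i z) + r t z \<epsilon>) t z) \<and>
            (\<forall>t\<in>{0..T}. norm (r t z \<epsilon>) \<le> C * \<epsilon> ^ (k + 1)))))"

end

theory Submission
  imports Defs
begin

text \<open>
  The averaged equation is autonomous up to \<open>O(\<epsilon>\<^bsup>k+1\<^esup>)\<close>, so its solutions can be expanded by hand.
  If \<open>g\<^sub>1, \<dots>, g\<^bsub>m-1\<^esub>\<close> vanish, the right-hand side has size \<open>\<epsilon>\<^bsup>m\<^esup>\<close>, hence the solution through \<open>z\<close>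
  has moved by \<open>t \<epsilon>\<^bsup>m\<^esup> g\<^sub>m(z)\<close> to leading order, and feeding this back once into \<open>\<epsilon>\<^bsup>m\<^esup> g\<^sub>m\<close> gives
  \<open>\<zeta>(t) = z + t (\<Sum>i. \<epsilon>\<^bsup>i\<^esup> g\<^sub>i(z)) + \<epsilon>\<^bsup>2m\<^esup> (t\<^sup>2/2) dg\<^sub>m(z) g\<^sub>m(z)\<close>, which solves the averaged equation up
  to \<open>o(\<epsilon>\<^bsup>N\<^esup>)\<close> with \<open>N = min k (2m)\<close> (\<open>approx_orbit_residual\<close>).

  The change of variables turns \<open>\<zeta>\<close> into a curve \<open>y\<close> that solves the original equation up to
  \<open>o(\<epsilon>\<^bsup>N\<^esup>)\<close> (\<open>transformed_orbit_nearly_solves\<close>).  The stroboscopic condition and the periodicity of the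
  \<open>u\<^sub>i\<close> make the change of variables the identity at \<open>t = 0\<close> and \<open>t = T\<close>, so \<open>y(0) = z\<close> and
  \<open>y(T) = \<zeta>(T)\<close>.  Near-solutions with the same initial value stay close
  (\<open>ode_near_solution_shadows\<close>), so the time-\<open>T\<close> map equals \<open>\<zeta>(T)\<close> up to \<open>o(\<epsilon>\<^bsup>N\<^esup>)\<close>.  Comparing
  coefficients with the Melnikov expansion yields \<open>f\<^sub>i = T g\<^sub>i\<close> for \<open>i < 2m\<close>, and the relation with the
  term \<open>(T\<^sup>2/2) dg\<^sub>m g\<^sub>m\<close> for \<open>i = 2m\<close> (\<open>melnikov_averaged_relation\<close>).

  For the theorem take \<open>m = l\<close>.  When it is the \<open>f\<^sub>i\<close> that vanish below \<open>l\<close>, the same relation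
  with \<open>m = i\<close> gives \<open>T g\<^sub>i = f\<^sub>i = 0\<close> for \<open>i < l\<close> by induction on \<open>i\<close>.  The two forms of
  the relation of order \<open>2l\<close> agree because \<open>f\<^sub>l = T g\<^sub>l\<close> on the open set \<open>D\<close>.
\<close>

section \<open>Asymptotic estimates uniform in time\<close>

text \<open>
  The symbol \<open>o(\<epsilon>\<^bsup>N\<^esup>)\<close> as \<open>\<epsilon> \<rightarrow> 0\<^sup>+\<close>, uniform on \<open>[0,T]\<close>.  Values of time-\<open>T\<close> maps are treated as
  functions constant in \<open>t\<close>, so that they obey the same calculus as residuals of differential
  equations.
\<close>

definition uniform_little_o :: "real \<Rightarrow> nat \<Rightarrow> (real \<Rightarrow> real \<Rightarrow> 'a::real_normed_vector) \<Rightarrow> bool" where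
  "uniform_little_o T N a \<longleftrightarrow>
     (\<forall>\<eta>>0. \<forall>\<^sub>F \<epsilon> in at_right 0. \<forall>t\<in>{0..T}. norm (a \<epsilon> t) \<le> \<eta> * \<epsilon> ^ N)"

lemma eventually_at_right_0_in_interval:
  assumes "0 < (c::real)"
  shows "\<forall>\<^sub>F \<epsilon> in at_right 0. 0 < \<epsilon> \<and> \<epsilon> \<le> c"
  using eventually_at_right_real[OF assms] by (rule eventually_mono) auto

lemma uniform_little_oD:
  assumes "uniform_little_o T N a" "0 < \<eta>"
  shows "\<forall>\<^sub>F \<epsilon> in at_right 0. \<forall>t\<in>{0..T}. norm (a \<epsilon> t) \<le> \<eta> * \<epsilon> ^ N"
  using assms unfolding uniform_little_o_def by blast

lemma uniform_little_o_bound: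
  assumes b: "uniform_little_o T N b"
    and le: "\<forall>\<^sub>F \<epsilon> in at_right 0. \<forall>t\<in>{0..T}. norm (a \<epsilon> t) \<le> C * norm (b \<epsilon> t)"
  shows "uniform_little_o T N a"
  unfolding uniform_little_o_def
proof (intro allI impI)
  fix \<eta> :: real assume "\<eta> > 0"
  then have pos: "\<eta> / (\<bar>C\<bar> + 1) > 0" by simp
  from uniform_little_oD[OF b this] le
  show "\<forall>\<^sub>F \<epsilon> in at_right 0. \<forall>t\<in>{0..T}. norm (a \<epsilon> t) \<le> \<eta> * \<epsilon> ^ N"
  proof eventually_elim
    case (elim \<epsilon>)
    show ?case
    proof
      fix t assume t: "t \<in> {0..T}"
      have "norm (a \<epsilon> t) \<le> C * norm (b \<epsilon> t)" using elim t by blast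
      also have "\<dots> \<le> (\<bar>C\<bar> + 1) * norm (b \<epsilon> t)" by (intro mult_right_mono) auto
      also have "\<dots> \<le> (\<bar>C\<bar> + 1) * (\<eta> / (\<bar>C\<bar> + 1) * \<epsilon> ^ N)"
        using elim t by (intro mult_left_mono) auto
      also have "\<dots> = \<eta> * \<epsilon> ^ N"
        by (simp add: add_nonneg_eq_0_iff divide_simps)
      finally show "norm (a \<epsilon> t) \<le> \<eta> * \<epsilon> ^ N" .
    qed
  qed
qed

lemma uniform_little_o_add:
  assumes "uniform_little_o T N a" "uniform_little_o T N b"
  shows "uniform_little_o T N (\<lambda>\<epsilon> t. a \<epsilon> t + b \<epsilon> t)"
  unfolding uniform_little_o_def
proof (intro allI impI)
  fix \<eta> :: real assume "\<eta> > 0"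
  then have pos: "\<eta> / 2 > 0" by simp
  from uniform_little_oD[OF assms(1) this] uniform_little_oD[OF assms(2) this]
  show "\<forall>\<^sub>F \<epsilon> in at_right 0. \<forall>t\<in>{0..T}. norm (a \<epsilon> t + b \<epsilon> t) \<le> \<eta> * \<epsilon> ^ N"
  proof eventually_elim
    case (elim \<epsilon>)
    show ?case
    proof
      fix t assume t: "t \<in> {0..T}"
      have "norm (a \<epsilon> t + b \<epsilon> t) \<le> norm (a \<epsilon> t) + norm (b \<epsilon> t)" by (rule norm_triangle_ineq)
      also have "\<dots> \<le> \<eta> / 2 * \<epsilon> ^ N + \<eta> / 2 * \<epsilon> ^ N" using elim t by (intro add_mono) auto
      finally show "norm (a \<epsilon> t + b \<epsilon> t) \<le> \<eta> * \<epsilon> ^ N" by simp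
    qed
  qed
qed

lemma uniform_little_o_zero: "uniform_little_o T N (\<lambda>\<epsilon> t. 0)"
  unfolding uniform_little_o_def
  by (auto intro!: eventually_mono[OF eventually_at_right_less])

lemma uniform_little_o_sum:
  assumes "finite I" "\<And>i. i \<in> I \<Longrightarrow> uniform_little_o T N (a i)"
  shows "uniform_little_o T N (\<lambda>\<epsilon> t. \<Sum>i\<in>I. a i \<epsilon> t)"
  using assms by (induction I) (auto intro: uniform_little_o_add uniform_little_o_zero)

lemma uniform_little_o_higher_power:
  assumes le: "\<forall>\<^sub>F \<epsilon> in at_right 0. \<forall>t\<in>{0..T}. norm (a \<epsilon> t) \<le> C * \<epsilon> ^ M" and "N < M"
  shows "uniform_little_o T N a"
  unfolding uniform_little_o_def
proof (intro allI impI)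
  fix \<eta> :: real assume \<eta>: "\<eta> > 0"
  then have pos: "min 1 (\<eta> / (\<bar>C\<bar> + 1)) > 0" by simp
  from le eventually_at_right_0_in_interval[OF this]
  show "\<forall>\<^sub>F \<epsilon> in at_right 0. \<forall>t\<in>{0..T}. norm (a \<epsilon> t) \<le> \<eta> * \<epsilon> ^ N"
  proof eventually_elim
    case (elim \<epsilon>)
    have "C * \<epsilon> ^ M \<le> (\<bar>C\<bar> + 1) * \<epsilon> ^ Suc N"
      using elim \<open>N < M\<close> by (intro mult_mono power_decreasing) auto
    also have "\<dots> = ((\<bar>C\<bar> + 1) * \<epsilon>) * \<epsilon> ^ N" by simp
    also have "\<dots> \<le> \<eta> * \<epsilon> ^ N"
      using elim by (intro mult_right_mono) (auto simp: field_simps)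
    finally show ?case using elim by force
  qed
qed

lemma uniform_little_o_mono:
  assumes a: "uniform_little_o T M a" and "N \<le> M"
  shows "uniform_little_o T N a"
  unfolding uniform_little_o_def
proof (intro allI impI)
  fix \<eta> :: real assume \<eta>: "\<eta> > 0"
  from uniform_little_oD[OF a this] eventually_at_right_0_in_interval[OF zero_less_one]
  show "\<forall>\<^sub>F \<epsilon> in at_right 0. \<forall>t\<in>{0..T}. norm (a \<epsilon> t) \<le> \<eta> * \<epsilon> ^ N"
  proof eventually_elim
    case (elim \<epsilon>)
    have "\<eta> * \<epsilon> ^ M \<le> \<eta> * \<epsilon> ^ N"
      using elim \<open>N \<le> M\<close> \<eta> by (intro mult_left_mono power_decreasing) auto
    then show ?case using elim by force
  qed
qed

text \<open>
  Letting \<open>\<epsilon> \<rightarrow> 0\<^sup>+\<close> gives \<open>a 0 = 0\<close>; dividing by \<open>\<epsilon>\<close> then lowers \<open>N\<close> by one.  This is the uniqueness of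
  asymptotic expansions; the degree \<open>M\<close> may exceed \<open>N\<close>, in which case the higher coefficients stay
  undetermined.
\<close>

lemma polynomial_coeffs_eq_0_of_little_o:
  fixes a :: "nat \<Rightarrow> 'a::real_normed_vector"
  assumes "0 \<le> T" "uniform_little_o T N (\<lambda>\<epsilon> t. \<Sum>i\<le>M. \<epsilon> ^ i *\<^sub>R a i)" "N \<le> M" "i \<le> N"
  shows "a i = 0"
  using assms(2-4)
proof (induction N arbitrary: a M i)
  case (0 a M i)
  show ?case
  proof (rule ccontr)
    assume "a i \<noteq> 0"
    then have pos: "norm (a 0) / 2 > 0" using 0 by simp
    have "((\<lambda>\<epsilon>. norm (\<Sum>i\<le>M. \<epsilon> ^ i *\<^sub>R a i)) \<longlongrightarrow> norm (\<Sum>i\<le>M. 0 ^ i *\<^sub>R a i)) (at_right (0::real))"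
      by (intro tendsto_intros)
    moreover have "(\<Sum>i\<le>M. (0::real) ^ i *\<^sub>R a i) = a 0"
      by (simp add: sum.atMost_shift)
    ultimately have lim: "((\<lambda>\<epsilon>. norm (\<Sum>i\<le>M. \<epsilon> ^ i *\<^sub>R a i)) \<longlongrightarrow> norm (a 0)) (at_right (0::real))"
      by simp
    have "norm (a 0) \<le> norm (a 0) / 2"
    proof (rule tendsto_upperbound[OF lim])
      show "\<forall>\<^sub>F \<epsilon> in at_right 0. norm (\<Sum>i\<le>M. \<epsilon> ^ i *\<^sub>R a i) \<le> norm (a 0) / 2"
        using uniform_little_oD[OF 0(1) pos] by (rule eventually_mono) (use assms(1) in auto)
    qed simp
    then show False using pos by simp
  qed
next
  case (Suc N a M i)
  have a0: "a 0 = 0"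
    by (rule Suc.IH[OF uniform_little_o_mono[OF Suc.prems(1)]]) (use Suc.prems in auto)
  obtain M' where M: "M = Suc M'" using Suc.prems by (cases M) auto
  have shift: "(\<Sum>i\<le>M. \<epsilon> ^ i *\<^sub>R a i) = \<epsilon> *\<^sub>R (\<Sum>i\<le>M'. \<epsilon> ^ i *\<^sub>R a (Suc i))" for \<epsilon> :: real
    unfolding M sum.atMost_Suc_shift by (simp add: a0 scaleR_sum_right)
  have "uniform_little_o T N (\<lambda>\<epsilon> t. \<Sum>i\<le>M'. \<epsilon> ^ i *\<^sub>R a (Suc i))"
    unfolding uniform_little_o_def
  proof (intro allI impI)
    fix \<eta> :: real assume "\<eta> > 0"
    from uniform_little_oD[OF Suc.prems(1) this] eventually_at_right_less[of 0]
    show "\<forall>\<^sub>F \<epsilon> in at_right 0. \<forall>t\<in>{0..T}. norm (\<Sum>i\<le>M'. \<epsilon> ^ i *\<^sub>R a (Suc i)) \<le> \<eta> * \<epsilon> ^ N"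
      by eventually_elim (auto simp: shift mult.left_commute)
  qed
  then have "a (Suc j) = 0" if "j \<le> N" for j
    using Suc.IH[of "\<lambda>i. a (Suc i)" M' j] Suc.prems M that by auto
  with a0 show ?case using Suc.prems by (cases i) auto
qed

section \<open>Bounds for smooth functions on compact sets\<close>

lemma finite_common_bound:
  assumes "finite I" "\<And>i. i \<in> I \<Longrightarrow> \<exists>B. P i B"
    and mono: "\<And>i B B'. P i B \<Longrightarrow> B \<le> B' \<Longrightarrow> P i (B'::real)"
  obtains B where "B \<ge> 0" "\<And>i. i \<in> I \<Longrightarrow> P i B"
proof -
  obtain b where b: "\<And>i. i \<in> I \<Longrightarrow> P i (b i)" using assms(2) by metis
  have "P i (\<Sum>i\<in>I. \<bar>b i\<bar>)" if "i \<in> I" for i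
  proof (rule mono[OF b[OF that]])
    have "\<bar>b i\<bar> \<le> (\<Sum>i\<in>I. \<bar>b i\<bar>)" using assms(1) that by (intro member_le_sum) auto
    then show "b i \<le> (\<Sum>i\<in>I. \<bar>b i\<bar>)" by linarith
  qed
  then show ?thesis by (intro that[of "\<Sum>i\<in>I. \<bar>b i\<bar>"]) (auto intro: sum_nonneg)
qed

lemma continuous_on_compact_norm_bound:
  fixes f :: "'a::metric_space \<Rightarrow> 'b::real_normed_vector"
  assumes "continuous_on S f" "compact C" "C \<subseteq> S"
  obtains B where "B \<ge> 0" "\<And>x. x \<in> C \<Longrightarrow> norm (f x) \<le> B"
proof -
  have "bounded (f ` C)"
    by (intro compact_imp_bounded compact_continuous_image assms continuous_on_subset[OF assms(1)])
  then obtain B where "\<And>x. x \<in> C \<Longrightarrow> norm (f x) \<le> B" unfolding bounded_iff by blast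
  then have "\<And>x. x \<in> C \<Longrightarrow> norm (f x) \<le> \<bar>B\<bar>" by force
  then show ?thesis by (intro that[of "\<bar>B\<bar>"]) auto
qed

lemma smooth_on_imp_continuous_on: "smooth_on f S \<Longrightarrow> continuous_on S f"
  unfolding smooth_on_def by (metis Ck_on.simps(1))

text \<open>
  Continuity of the derivative is known only direction by direction; the sum of the bounds in the
  finitely many basis directions controls all directions at once.
\<close>

lemma smooth_on_bounded_derivative:
  fixes f :: "'a::euclidean_space \<Rightarrow> 'b::real_normed_vector"
  assumes "smooth_on f S" "open S" "compact C" "C \<subseteq> S"
  obtains f' B where "\<And>x. x \<in> S \<Longrightarrow> (f has_derivative f' x) (at x)" "B \<ge> 0"
    "\<And>x v. x \<in> C \<Longrightarrow> norm (f' x v) \<le> B * norm v"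
proof -
  have "Ck_on (Suc 0) f S" using assms(1) unfolding smooth_on_def by blast
  then obtain f' where f': "\<And>x. x \<in> S \<Longrightarrow> (f has_derivative f' x) (at x within S)"
    and cont: "\<And>v. continuous_on S (\<lambda>x. f' x v)" by auto
  have der: "(f has_derivative f' x) (at x)" if "x \<in> S" for x
    using f'[OF that] at_within_open[OF that assms(2)] by simp
  have "\<exists>B. \<forall>x\<in>C. norm (f' x b) \<le> B" for b
    using continuous_on_compact_norm_bound[OF cont assms(3,4)] by metis
  then obtain B where B: "B \<ge> 0" "\<And>b. b \<in> Basis \<Longrightarrow> \<forall>x\<in>C. norm (f' x b) \<le> B"
    by (rule finite_common_bound[OF finite_Basis, where P = "\<lambda>b B. \<forall>x\<in>C. norm (f' x b) \<le> B"]) force+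
  have "norm (f' x v) \<le> (real DIM('a) * B) * norm v" if x: "x \<in> C" for x v
  proof -
    have lin: "linear (f' x)" using der x assms(4) has_derivative_linear by blast
    have "norm (f' x v) = norm (\<Sum>b\<in>Basis. (v \<bullet> b) *\<^sub>R f' x b)"
      by (subst euclidean_representation[of v, symmetric])
        (simp only: linear_sum[OF lin] linear_cmul[OF lin])
    also have "\<dots> \<le> (\<Sum>b\<in>(Basis::'a set). norm v * B)"
    proof (rule sum_norm_le)
      fix b :: 'a assume b: "b \<in> Basis"
      have "\<bar>v \<bullet> b\<bar> * norm (f' x b) \<le> norm v * B"
        using b B x by (intro mult_mono Basis_le_norm) auto
      then show "norm ((v \<bullet> b) *\<^sub>R f' x b) \<le> norm v * B" by simp
    qed
    finally show ?thesis by (simp add: mult_ac)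
  qed
  then show ?thesis using der B(1) by (intro that[of f' "real DIM('a) * B"]) auto
qed

lemma smooth_on_lipschitz_on_compact_convex:
  fixes f :: "'a::euclidean_space \<Rightarrow> 'b::real_normed_vector"
  assumes "smooth_on f S" "open S" "compact C" "convex C" "C \<subseteq> S"
  obtains L where "L \<ge> 0" "\<And>x y. x \<in> C \<Longrightarrow> y \<in> C \<Longrightarrow> norm (f x - f y) \<le> L * norm (x - y)"
proof -
  obtain f' B where f': "\<And>x. x \<in> S \<Longrightarrow> (f has_derivative f' x) (at x)" and "B \<ge> 0"
    and B: "\<And>x v. x \<in> C \<Longrightarrow> norm (f' x v) \<le> B * norm v"
    using smooth_on_bounded_derivative[OF assms(1,2,3,5)] by metis
  have "norm (f x - f y) \<le> B * norm (x - y)" if "x \<in> C" "y \<in> C" for x y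
    using that assms(5)
    by (intro differentiable_bound[OF assms(4), of f f' B] has_derivative_at_withinI[OF f'] onorm_le B)
      auto
  with \<open>B \<ge> 0\<close> show ?thesis by (rule that)
qed

lemma smooth_on_differentiable:
  assumes "smooth_on f S" "open S" "x \<in> S"
  shows "f differentiable (at x)"
proof -
  have "Ck_on (Suc 0) f S" using assms(1) unfolding smooth_on_def by blast
  then obtain f' where "(f has_derivative f') (at x within S)" using assms(3) by auto
  then show ?thesis
    using at_within_open[OF assms(3,2)] by (auto simp: differentiable_def)
qed

section \<open>Near-solutions of differential equations\<close>

lemma vector_derivative_growth_bound:
  fixes w :: "real \<Rightarrow> 'a::real_normed_vector"
  assumes der: "\<And>s. s \<in> {0..T} \<Longrightarrow> (w has_vector_derivative w' s) (at s within {0..T})"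
    and "0 \<le> t" "t \<le> T" and M: "\<And>s. 0 < s \<Longrightarrow> s < t \<Longrightarrow> norm (w' s) \<le> M"
  shows "norm (w t - w 0) \<le> M * t"
proof (cases "t = 0")
  case False
  have "norm (w t - w 0) \<le> M * t - M * 0"
  proof (rule differentiable_bound_general[where f = w and f' = w' and \<phi> = "\<lambda>s. M * s" and \<phi>' = "\<lambda>_. M"])
    show "continuous_on {0..t} w"
      by (rule continuous_on_subset[OF continuous_on_vector_derivative[OF der]]) (use \<open>t \<le> T\<close> in auto)
    show "(w has_vector_derivative w' s) (at s)" if "0 < s" "s < t" for s
      using der[of s] that \<open>t \<le> T\<close> at_within_Icc_at[of 0 s T] by simp
    show "((\<lambda>s. M * s) has_vector_derivative M) (at s)" for s
      using has_vector_derivative_mult_right[OF has_vector_derivative_id, where a = M and F = "at s"] by simp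
    show "norm (w' s) \<le> M" if "0 < s" "s < t" for s by (rule M[OF that])
    show "0 < t" using False \<open>0 \<le> t\<close> by simp
    show "continuous_on {0..t} (\<lambda>s. M * s)" by (intro continuous_intros)
  qed
  then show ?thesis by simp
qed simp

text \<open>
  At the first time where the distance from \<open>z\<close> reaches \<open>\<rho>\<close>, the curve has so far moved at speed at
  most \<open>B\<close>, hence by at most \<open>T * B < \<rho>\<close>.  The speed bound is only required inside the ball, which is
  where a vector field defined on an open set can be bounded.
\<close>

lemma slow_curve_stays_in_cball:
  fixes x :: "real \<Rightarrow> 'a::real_normed_vector"
  assumes der: "\<And>s. s \<in> {0..T} \<Longrightarrow> (x has_vector_derivative x' s) (at s within {0..T})"
    and x0: "x 0 = z"
    and B: "\<And>s. s \<in> {0..T} \<Longrightarrow> x s \<in> cball z \<rho> \<Longrightarrow> norm (x' s) \<le> B"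
    and small: "T * B < \<rho>" and "0 \<le> B" and t: "t \<in> {0..T}"
  shows "x t \<in> cball z \<rho>"
proof (rule ccontr)
  assume out: "x t \<notin> cball z \<rho>"
  have cont: "continuous_on {0..t} x"
    by (rule continuous_on_subset[OF continuous_on_vector_derivative[OF der]]) (use t in auto)

  define S where "S = {0..t} \<inter> (\<lambda>s. dist z (x s)) -` {\<rho>..}"
  have "closed S"
    unfolding S_def using cont by (intro continuous_closed_preimage continuous_intros) auto
  moreover have "S \<noteq> {}" "bdd_below S" using out t by (auto simp: S_def)
  ultimately have \<tau>: "Inf S \<in> S" by (intro closed_contains_Inf) auto
  define \<tau> where "\<tau> = Inf S"
  have \<tau>T: "0 \<le> \<tau>" "\<tau> \<le> T" and far: "\<rho> \<le> dist z (x \<tau>)"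
    using \<tau> t by (auto simp: S_def \<tau>_def)
  have before: "x s \<in> cball z \<rho>" if "0 < s" "s < \<tau>" for s
  proof (rule ccontr)
    assume "x s \<notin> cball z \<rho>"
    then have "s \<in> S" using that \<tau> by (auto simp: S_def \<tau>_def)
    then have "\<tau> \<le> s" unfolding \<tau>_def using \<open>bdd_below S\<close> by (intro cInf_lower)
    then show False using that by simp
  qed
  have "norm (x \<tau> - x 0) \<le> B * \<tau>"
    using before \<tau>T by (intro vector_derivative_growth_bound[OF der] B) auto
  also have "\<dots> \<le> B * T" using \<tau>T \<open>0 \<le> B\<close> by (intro mult_left_mono) auto
  also have "\<dots> < \<rho>" using small by (simp add: mult.commute)
  finally show False using far x0 by (simp add: dist_norm norm_minus_commute)
qed

text \<open>
  A substitute for Gronwall's inequality when the Lipschitz constant is small, as it is for a field of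
  size \<open>O(\<epsilon>)\<close>: if \<open>M\<close> is the maximum of \<open>norm (x - y)\<close>, integrating the difference of the equations
  gives \<open>M \<le> T * L * M + T * (\<delta>1 + \<delta>2)\<close>, and \<open>T * L \<le> 1/2\<close> allows \<open>M\<close> to be absorbed on the left.
\<close>

lemma nearly_solutions_close:
  fixes x y :: "real \<Rightarrow> 'a::real_normed_vector"
  assumes dx: "\<And>s. s \<in> {0..T} \<Longrightarrow> (x has_vector_derivative x' s) (at s within {0..T})"
    and dy: "\<And>s. s \<in> {0..T} \<Longrightarrow> (y has_vector_derivative y' s) (at s within {0..T})"
    and x': "\<And>s. s \<in> {0..T} \<Longrightarrow> norm (x' s - X s (x s)) \<le> \<delta>1"
    and y': "\<And>s. s \<in> {0..T} \<Longrightarrow> norm (y' s - X s (y s)) \<le> \<delta>2"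
    and L: "\<And>s. s \<in> {0..T} \<Longrightarrow> norm (X s (x s) - X s (y s)) \<le> L * norm (x s - y s)"
    and start: "x 0 = y 0" and "0 < T" "0 \<le> L" and small: "T * L \<le> 1 / 2"
  shows "norm (x T - y T) \<le> 2 * T * (\<delta>1 + \<delta>2)"
proof -
  define w where "w s = x s - y s" for s
  have dw: "(w has_vector_derivative x' s - y' s) (at s within {0..T})" if "s \<in> {0..T}" for s
    unfolding w_def using dx dy that by (intro derivative_intros) auto
  have "continuous_on {0..T} (\<lambda>s. norm (w s))"
    using dw by (intro continuous_on_norm continuous_on_vector_derivative) auto
  then obtain \<tau> where \<tau>: "\<tau> \<in> {0..T}" and max: "\<And>s. s \<in> {0..T} \<Longrightarrow> norm (w s) \<le> norm (w \<tau>)"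
    using continuous_attains_sup[of "{0..T}" "\<lambda>s. norm (w s)"] \<open>0 < T\<close> by auto
  define M where "M = norm (w \<tau>)"
  have rate: "norm (x' s - y' s) \<le> L * M + (\<delta>1 + \<delta>2)" if s: "s \<in> {0..T}" for s
  proof -
    have "x' s - y' s = (X s (x s) - X s (y s)) + ((x' s - X s (x s)) - (y' s - X s (y s)))" by simp
    also have "norm \<dots> \<le> norm (X s (x s) - X s (y s)) + (norm (x' s - X s (x s)) + norm (y' s - X s (y s)))"
      by (intro order_trans[OF norm_triangle_ineq] add_left_mono norm_triangle_ineq4)
    also have "\<dots> \<le> L * norm (w s) + (\<delta>1 + \<delta>2)"
      unfolding w_def using L[OF s] x'[OF s] y'[OF s] by (intro add_mono) auto
    also have "L * norm (w s) \<le> L * M"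
      unfolding M_def using max[OF s] \<open>0 \<le> L\<close> by (rule mult_left_mono)
    finally show ?thesis by simp
  qed
  have nn: "0 \<le> L * M + (\<delta>1 + \<delta>2)" using rate[OF \<tau>] norm_ge_zero order_trans by blast
  have "norm (w \<tau> - w 0) \<le> (L * M + (\<delta>1 + \<delta>2)) * \<tau>"
    using \<tau> rate by (intro vector_derivative_growth_bound[OF dw]) auto
  also have "\<dots> \<le> (L * M + (\<delta>1 + \<delta>2)) * T"
    using \<tau> nn by (intro mult_left_mono) auto
  finally have "M \<le> (T * L) * M + T * (\<delta>1 + \<delta>2)"
    by (simp add: M_def w_def start algebra_simps)
  also have "(T * L) * M \<le> 1 / 2 * M"
    unfolding M_def using small by (intro mult_right_mono) auto
  finally have "M \<le> 2 * T * (\<delta>1 + \<delta>2)" by simp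
  moreover have "norm (x T - y T) \<le> M"
    using max[of T] \<open>0 < T\<close> by (simp add: M_def w_def)
  ultimately show ?thesis by linarith
qed

text \<open>
  The straight line through \<open>w\<close> with velocity \<open>Z t w\<close> at time \<open>t\<close> is an admissible test curve, so the
  transformation property amounts to the identity \<open>U' (1, Z t w) = X t (U t w)\<close>.  For any other
  velocity \<open>v\<close> the chain rule then leaves the error \<open>U' (0, v - Z t w)\<close>.
\<close>

lemma transforms_ode_at_residual:
  assumes tr: "transforms_ode_at U X Z t w"
    and U: "((\<lambda>(s, y). U s y) has_derivative U') (at (t, w))"
    and \<zeta>: "(\<zeta> has_vector_derivative v) (at t)" "\<zeta> t = w"
  shows "((\<lambda>s. U s (\<zeta> s)) has_vector_derivative X t (U t w) + U' (0, v - Z t w)) (at t)"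
proof -
  have chain: "((\<lambda>s. U s (\<xi> s)) has_vector_derivative U' (1, c)) (at t)"
    if "(\<xi> has_vector_derivative c) (at t)" "\<xi> t = w" for \<xi> c
  proof -
    have "((\<lambda>s. (s, \<xi> s)) has_vector_derivative (1, c)) (at t)"
      using that(1) unfolding has_vector_derivative_def
      by (auto intro!: derivative_eq_intros)
    then have "((\<lambda>(s, y). U s y) \<circ> (\<lambda>s. (s, \<xi> s)) has_vector_derivative U' (1, c)) (at t)"
      by (rule vector_derivative_diff_chain_within)
        (use U that(2) in \<open>auto intro: has_derivative_at_withinI\<close>)
    then show ?thesis by (simp add: o_def)
  qed
  define \<xi> where "\<xi> s = w + (s - t) *\<^sub>R Z t w" for s
  have \<xi>: "(\<xi> has_vector_derivative Z t w) (at t)" "\<xi> t = w"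
    unfolding \<xi>_def has_vector_derivative_def by (auto intro!: derivative_eq_intros)
  then have "\<xi> differentiable (at t)"
    by (auto simp: has_vector_derivative_def differentiable_def)
  with tr \<xi> have "((\<lambda>s. U s (\<xi> s)) has_vector_derivative X t (U t w)) (at t)"
    unfolding transforms_ode_at_def by blast
  then have "X t (U t w) = U' (1, Z t w)"
    using chain[OF \<xi>] vector_derivative_unique_at by blast
  moreover have "U' (1, v) = U' (1, Z t w) + U' (0, v - Z t w)"
    using has_derivative_linear[OF U] by (simp flip: linear_add)
  ultimately show ?thesis using chain[OF \<zeta>] by simp
qed

section \<open>Approximate orbits of the averaged equation\<close>

text \<open>
  The second Picard iterate for \<open>\<zeta>' = (\<Sum>i. \<epsilon>\<^bsup>i\<^esup> g\<^sub>i(\<zeta>))\<close> from \<open>z\<close>, of which only the quadratic term of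
  order \<open>\<epsilon>\<^bsup>2m\<^esup>\<close> is kept; \<open>m\<close> is meant to be the index of the first \<open>g\<^sub>i\<close> that may be nonzero.
\<close>

definition approx_orbit ::
  "nat \<Rightarrow> (nat \<Rightarrow> 'a \<Rightarrow> 'a) \<Rightarrow> nat \<Rightarrow> 'a \<Rightarrow> real \<Rightarrow> real \<Rightarrow> 'a::real_normed_vector" where
  "approx_orbit k g m z \<epsilon> t =
     z + t *\<^sub>R (\<Sum>i=1..k. \<epsilon> ^ i *\<^sub>R g i z)
       + (\<epsilon> ^ (2 * m) * t\<^sup>2 / 2) *\<^sub>R frechet_derivative (g m) (at z) (g m z)"

lemma approx_orbit_has_vector_derivative:
  "(approx_orbit k g m z \<epsilon> has_vector_derivative
     (\<Sum>i=1..k. \<epsilon> ^ i *\<^sub>R g i z)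
       + (\<epsilon> ^ (2 * m) * t) *\<^sub>R frechet_derivative (g m) (at z) (g m z)) (at t)"
  unfolding approx_orbit_def[abs_def] has_vector_derivative_def
  by (auto intro!: derivative_eq_intros simp: algebra_simps)

lemma norm_power_sum_le:
  fixes a :: "nat \<Rightarrow> 'a::real_normed_vector"
  assumes "finite I" "\<And>i. i \<in> I \<Longrightarrow> n \<le> i" "\<And>i. i \<in> I \<Longrightarrow> norm (a i) \<le> b i" "0 \<le> \<epsilon>" "\<epsilon> \<le> 1"
  shows "norm (\<Sum>i\<in>I. \<epsilon> ^ i *\<^sub>R a i) \<le> \<epsilon> ^ n * (\<Sum>i\<in>I. b i)"
  unfolding sum_distrib_left
proof (rule sum_norm_le)
  fix i assume "i \<in> I"
  then show "norm (\<epsilon> ^ i *\<^sub>R a i) \<le> \<epsilon> ^ n * b i"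
    using assms by (simp add: mult_mono power_decreasing)
qed

lemma approx_orbit_displacement:
  fixes z :: "'a::real_normed_vector"
  assumes "0 \<le> T" "1 \<le> m" "m \<le> k" and zero: "\<And>i. i \<in> {1..<m} \<Longrightarrow> g i z = 0"
  obtains C where "0 \<le> C"
    "\<And>\<epsilon> t. 0 \<le> \<epsilon> \<Longrightarrow> \<epsilon> \<le> 1 \<Longrightarrow> t \<in> {0..T} \<Longrightarrow>
       norm (approx_orbit k g m z \<epsilon> t - z) \<le> C * \<epsilon> ^ m"
    "\<And>\<epsilon> t. 0 \<le> \<epsilon> \<Longrightarrow> \<epsilon> \<le> 1 \<Longrightarrow> t \<in> {0..T} \<Longrightarrow>
       norm (approx_orbit k g m z \<epsilon> t - z - (t * \<epsilon> ^ m) *\<^sub>R g m z) \<le> C * \<epsilon> ^ Suc m"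
proof -
  define h where "h = frechet_derivative (g m) (at z) (g m z)"
  define G where "G = (\<Sum>i=Suc m..k. norm (g i z))"
  define E where "E = T * G + T\<^sup>2 * norm h"
  have "0 \<le> G" unfolding G_def by (intro sum_nonneg) auto
  then have E: "0 \<le> E" unfolding E_def using \<open>0 \<le> T\<close> by simp
  have split: "(\<Sum>i=1..k. \<epsilon> ^ i *\<^sub>R g i z) = \<epsilon> ^ m *\<^sub>R g m z + (\<Sum>i=Suc m..k. \<epsilon> ^ i *\<^sub>R g i z)"
    for \<epsilon> :: real
  proof -
    have "(\<Sum>i=1..k. \<epsilon> ^ i *\<^sub>R g i z) = (\<Sum>i=m..k. \<epsilon> ^ i *\<^sub>R g i z)"
      using assms by (intro sum.mono_neutral_right) auto
    then show ?thesis using assms by (simp add: sum.atLeast_Suc_atMost)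
  qed
  have second: "norm (approx_orbit k g m z \<epsilon> t - z - (t * \<epsilon> ^ m) *\<^sub>R g m z) \<le> E * \<epsilon> ^ Suc m"
    if \<epsilon>: "0 \<le> \<epsilon>" "\<epsilon> \<le> 1" and t: "t \<in> {0..T}" for \<epsilon> t
  proof -
    have "approx_orbit k g m z \<epsilon> t - z - (t * \<epsilon> ^ m) *\<^sub>R g m z
        = t *\<^sub>R (\<Sum>i=Suc m..k. \<epsilon> ^ i *\<^sub>R g i z) + (\<epsilon> ^ (2 * m) * t\<^sup>2 / 2) *\<^sub>R h"
      unfolding approx_orbit_def split h_def by (simp add: algebra_simps)
    also have "norm \<dots> \<le> t * norm (\<Sum>i=Suc m..k. \<epsilon> ^ i *\<^sub>R g i z) + \<epsilon> ^ (2 * m) * (t\<^sup>2 / 2) * norm h"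
      using \<epsilon> t by (intro order_trans[OF norm_triangle_ineq]) simp
    also have "\<dots> \<le> T * (\<epsilon> ^ Suc m * G) + \<epsilon> ^ Suc m * T\<^sup>2 * norm h"
    proof (intro add_mono mult_mono)
      show "norm (\<Sum>i=Suc m..k. \<epsilon> ^ i *\<^sub>R g i z) \<le> \<epsilon> ^ Suc m * G"
        unfolding G_def using \<epsilon> by (intro norm_power_sum_le) auto
      show "\<epsilon> ^ (2 * m) \<le> \<epsilon> ^ Suc m" using \<epsilon> \<open>1 \<le> m\<close> by (intro power_decreasing) auto
      have "t\<^sup>2 \<le> T\<^sup>2" using t by (intro power_mono) auto
      then show "t\<^sup>2 / 2 \<le> T\<^sup>2" using zero_le_power2[of T] by linarith
    qed (use \<epsilon> t in auto)
    also have "\<dots> = E * \<epsilon> ^ Suc m" by (simp add: E_def algebra_simps)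
    finally show ?thesis .
  qed
  have first: "norm (approx_orbit k g m z \<epsilon> t - z) \<le> (E + T * norm (g m z)) * \<epsilon> ^ m"
    if \<epsilon>: "0 \<le> \<epsilon>" "\<epsilon> \<le> 1" and t: "t \<in> {0..T}" for \<epsilon> t
  proof -
    have "norm (approx_orbit k g m z \<epsilon> t - z)
        \<le> norm (approx_orbit k g m z \<epsilon> t - z - (t * \<epsilon> ^ m) *\<^sub>R g m z) + norm ((t * \<epsilon> ^ m) *\<^sub>R g m z)"
      using norm_triangle_sub by (metis add.commute)
    also have "\<dots> \<le> E * \<epsilon> ^ Suc m + T * \<epsilon> ^ m * norm (g m z)"
      using \<epsilon> t by (intro add_mono second) (auto intro!: mult_right_mono)
    also have "E * \<epsilon> ^ Suc m \<le> E * \<epsilon> ^ m"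
      using \<epsilon> E by (intro mult_left_mono power_decreasing) auto
    finally show ?thesis by (simp add: algebra_simps)
  qed
  show ?thesis
  proof (rule that[of "E + T * norm (g m z)"])
    show "0 \<le> E + T * norm (g m z)" using E \<open>0 \<le> T\<close> by simp
    fix \<epsilon> t :: real assume \<epsilon>: "0 \<le> \<epsilon>" "\<epsilon> \<le> 1" and t: "t \<in> {0..T}"
    have "E * \<epsilon> ^ Suc m \<le> (E + T * norm (g m z)) * \<epsilon> ^ Suc m"
      using \<epsilon> \<open>0 \<le> T\<close> by (intro mult_right_mono) auto
    then show "norm (approx_orbit k g m z \<epsilon> t - z - (t * \<epsilon> ^ m) *\<^sub>R g m z)
        \<le> (E + T * norm (g m z)) * \<epsilon> ^ Suc m"
      using second[OF \<epsilon> t] by linarith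
  qed (fact first)
qed

lemma eventually_approx_orbit_near:
  fixes z :: "'a::real_normed_vector"
  assumes "0 \<le> T" "1 \<le> m" "m \<le> k" "\<And>i. i \<in> {1..<m} \<Longrightarrow> g i z = 0" "0 < \<delta>"
  shows "\<forall>\<^sub>F \<epsilon> in at_right 0. \<forall>t\<in>{0..T}. norm (approx_orbit k g m z \<epsilon> t - z) < \<delta>"
proof -
  obtain C where C: "0 \<le> C" "\<And>\<epsilon> t. 0 \<le> \<epsilon> \<Longrightarrow> \<epsilon> \<le> 1 \<Longrightarrow> t \<in> {0..T} \<Longrightarrow>
       norm (approx_orbit k g m z \<epsilon> t - z) \<le> C * \<epsilon> ^ m"
    using approx_orbit_displacement[of T m k g z] assms(1-4) by metis
  have "min 1 (\<delta> / (C + 1)) > 0" using \<open>0 < \<delta>\<close> C by simp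
  from eventually_at_right_0_in_interval[OF this] show ?thesis
  proof eventually_elim
    case (elim \<epsilon>)
    have "C * \<epsilon> ^ m \<le> C * \<epsilon> ^ 1"
      using elim C \<open>1 \<le> m\<close> by (intro mult_left_mono power_decreasing) auto
    also have "\<dots> < (C + 1) * \<epsilon>" using elim by (simp add: algebra_simps)
    also have "\<dots> \<le> \<delta>" using elim C by (simp add: field_simps)
    finally have less: "C * \<epsilon> ^ m < \<delta>" .
    show ?case
    proof
      fix t assume t: "t \<in> {0..T}"
      have "norm (approx_orbit k g m z \<epsilon> t - z) \<le> C * \<epsilon> ^ m" using C(2)[of \<epsilon> t] elim t by auto
      with less show "norm (approx_orbit k g m z \<epsilon> t - z) < \<delta>" by linarith
    qed
  qed
qed

text \<open>
  Write \<open>d = \<zeta> - z = t \<epsilon>\<^bsup>m\<^esup> g\<^sub>m(z) + O(\<epsilon>\<^bsup>m+1\<^esup>)\<close>.  The index \<open>i = m\<close> contributes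
  \<open>- \<epsilon>\<^bsup>m\<^esup> (dg\<^sub>m(z) d + o(d))\<close>, whose leading part \<open>- \<epsilon>\<^bsup>2m\<^esup> t dg\<^sub>m(z) g\<^sub>m(z)\<close> is cancelled by the
  derivative of the quadratic term of \<open>\<zeta>\<close>.  An index \<open>i > m\<close> contributes
  \<open>\<epsilon>\<^bsup>i\<^esup> O(d) = O(\<epsilon>\<^bsup>2m+1\<^esup>)\<close>, and an index \<open>i < m\<close> contributes nothing near \<open>z\<close>.
\<close>

lemma approx_orbit_residual:
  fixes z :: "'a::real_normed_vector"
  assumes "0 \<le> T" "1 \<le> m" "m \<le> k" "open D" "z \<in> D"
    and diff: "\<And>i. i \<in> {1..k} \<Longrightarrow> g i differentiable (at z)"
    and zero: "\<And>i x. i \<in> {1..<m} \<Longrightarrow> x \<in> D \<Longrightarrow> g i x = 0"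
  shows "uniform_little_o T (2 * m) (\<lambda>\<epsilon> t.
    (\<Sum>i=1..k. \<epsilon> ^ i *\<^sub>R g i z)
       + (\<epsilon> ^ (2 * m) * t) *\<^sub>R frechet_derivative (g m) (at z) (g m z)
       - (\<Sum>i=1..k. \<epsilon> ^ i *\<^sub>R g i (approx_orbit k g m z \<epsilon> t)))"
proof -
  define \<zeta> where "\<zeta> = approx_orbit k g m z"
  define g' where "g' i = frechet_derivative (g i) (at z)" for i
  have g': "(g i has_derivative g' i) (at z)" if "i \<in> {1..k}" for i
    using diff[OF that] unfolding g'_def by (simp add: frechet_derivative_works)
  have near: "\<forall>\<^sub>F \<epsilon> in at_right 0. \<forall>t\<in>{0..T}. norm (\<zeta> \<epsilon> t - z) < \<delta>" if "0 < \<delta>" for \<delta>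
    unfolding \<zeta>_def using assms that by (intro eventually_approx_orbit_near) auto
  obtain C where "0 \<le> C"
    and C1: "\<And>\<epsilon> t. 0 \<le> \<epsilon> \<Longrightarrow> \<epsilon> \<le> 1 \<Longrightarrow> t \<in> {0..T} \<Longrightarrow> norm (\<zeta> \<epsilon> t - z) \<le> C * \<epsilon> ^ m"
    and C2: "\<And>\<epsilon> t. 0 \<le> \<epsilon> \<Longrightarrow> \<epsilon> \<le> 1 \<Longrightarrow> t \<in> {0..T} \<Longrightarrow>
       norm (\<zeta> \<epsilon> t - z - (t * \<epsilon> ^ m) *\<^sub>R g m z) \<le> C * \<epsilon> ^ Suc m"
    unfolding \<zeta>_def
    using approx_orbit_displacement[OF assms(1-3), of g z] zero[OF _ \<open>z \<in> D\<close>] by metis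
  have unit: "\<forall>\<^sub>F \<epsilon>::real in at_right 0. 0 < \<epsilon> \<and> \<epsilon> \<le> 1"
    by (rule eventually_at_right_0_in_interval) simp
  define a where "a i \<epsilon> t = \<epsilon> ^ i *\<^sub>R (g i z - g i (\<zeta> \<epsilon> t))
      + (if i = m then (\<epsilon> ^ (2 * m) * t) *\<^sub>R g' m (g m z) else 0)" for i \<epsilon> t
  have "uniform_little_o T (2 * m) (a i)" if i: "i \<in> {1..k}" for i
  proof -
    obtain B where "B > 0" and B: "\<And>v. norm (g' i v) \<le> norm v * B"
      using bounded_linear.pos_bounded[OF has_derivative_bounded_linear[OF g'[OF i]]] by metis
    consider "i < m" | "i = m" | "m < i" by linarith
    then show ?thesis
    proof cases
      case 1
      obtain \<delta> where \<delta>: "0 < \<delta>" "ball z \<delta> \<subseteq> D"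
        using \<open>open D\<close> \<open>z \<in> D\<close> open_contains_ball by blast
      show ?thesis
      proof (rule uniform_little_o_bound[OF uniform_little_o_zero, where C = 1])
        show "\<forall>\<^sub>F \<epsilon> in at_right 0. \<forall>t\<in>{0..T}. norm (a i \<epsilon> t) \<le> 1 * norm (0::'a)"
          using near[OF \<delta>(1)]
        proof (rule eventually_mono, intro ballI)
          fix \<epsilon> t assume *: "\<forall>t\<in>{0..T}. norm (\<zeta> \<epsilon> t - z) < \<delta>" "t \<in> {0..T}"
          then have "\<zeta> \<epsilon> t \<in> D" using \<delta>(2) by (auto simp: dist_norm norm_minus_commute)
          then show "norm (a i \<epsilon> t) \<le> 1 * norm (0::'a)"
            using 1 i zero \<open>z \<in> D\<close> by (simp add: a_def)
        qed
      qed
    next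
      case 2
      define \<rho> where "\<rho> \<epsilon> t = g m (\<zeta> \<epsilon> t) - g m z - g' m (\<zeta> \<epsilon> t - z)" for \<epsilon> t
      have lin: "linear (g' m)" using g' 2 i has_derivative_linear by blast
      have split: "a i = (\<lambda>\<epsilon> t. \<epsilon> ^ m *\<^sub>R (- \<rho> \<epsilon> t)
          + \<epsilon> ^ m *\<^sub>R (- g' m (\<zeta> \<epsilon> t - z - (t * \<epsilon> ^ m) *\<^sub>R g m z)))"
        by (rule ext)+ (simp add: a_def \<rho>_def 2 linear_diff[OF lin] linear_add[OF lin]
            linear_cmul[OF lin] algebra_simps
            power_add mult_2 mult_2_right)
      have "uniform_little_o T (2 * m) (\<lambda>\<epsilon> t. \<epsilon> ^ m *\<^sub>R (- \<rho> \<epsilon> t))"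
        unfolding uniform_little_o_def
      proof (intro allI impI)
        fix \<eta> :: real assume "\<eta> > 0"
        then have \<eta>: "\<eta> / (C + 1) > 0" using \<open>0 \<le> C\<close> by simp
        then obtain \<delta> where "\<delta> > 0" and \<delta>: "\<And>y. norm (y - z) < \<delta> \<Longrightarrow>
            norm (g m y - g m z - g' m (y - z)) \<le> \<eta> / (C + 1) * norm (y - z)"
          using g'[OF i] 2 unfolding has_derivative_at_alt by blast
        from near[OF this(1)] unit
        show "\<forall>\<^sub>F \<epsilon> in at_right 0. \<forall>t\<in>{0..T}. norm (\<epsilon> ^ m *\<^sub>R (- \<rho> \<epsilon> t)) \<le> \<eta> * \<epsilon> ^ (2 * m)"
        proof eventually_elim
          case (elim \<epsilon>)
          show ?case
          proof
            fix t assume t: "t \<in> {0..T}"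
            have "norm (\<rho> \<epsilon> t) \<le> \<eta> / (C + 1) * norm (\<zeta> \<epsilon> t - z)"
              unfolding \<rho>_def using elim t by (intro \<delta>) auto
            also have "\<dots> \<le> \<eta> / (C + 1) * ((C + 1) * \<epsilon> ^ m)"
            proof (rule mult_left_mono)
              have le: "C * \<epsilon> ^ m \<le> (C + 1) * \<epsilon> ^ m" using elim by (intro mult_right_mono) auto
              show "norm (\<zeta> \<epsilon> t - z) \<le> (C + 1) * \<epsilon> ^ m"
                by (rule order_trans[OF C1 le]) (use elim t in auto)
            qed (use \<eta> in simp)
            also have "\<dots> = \<eta> * \<epsilon> ^ m" using \<open>0 \<le> C\<close> by simp
            finally have "\<epsilon> ^ m * norm (\<rho> \<epsilon> t) \<le> \<epsilon> ^ m * (\<eta> * \<epsilon> ^ m)"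
              using elim by (intro mult_left_mono) auto
            then show "norm (\<epsilon> ^ m *\<^sub>R (- \<rho> \<epsilon> t)) \<le> \<eta> * \<epsilon> ^ (2 * m)"
              using elim by (simp add: power_add mult_2 mult_2_right mult_ac)
          qed
        qed
      qed
      moreover have "uniform_little_o T (2 * m)
          (\<lambda>\<epsilon> t. \<epsilon> ^ m *\<^sub>R (- g' m (\<zeta> \<epsilon> t - z - (t * \<epsilon> ^ m) *\<^sub>R g m z)))"
      proof (rule uniform_little_o_higher_power[where C = "C * B" and M = "2 * m + 1"])
        show "\<forall>\<^sub>F \<epsilon> in at_right 0. \<forall>t\<in>{0..T}.
            norm (\<epsilon> ^ m *\<^sub>R (- g' m (\<zeta> \<epsilon> t - z - (t * \<epsilon> ^ m) *\<^sub>R g m z))) \<le> C * B * \<epsilon> ^ (2 * m + 1)"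
          using unit
        proof eventually_elim
          case (elim \<epsilon>)
          show ?case
          proof
            fix t assume t: "t \<in> {0..T}"
            have "norm (g' m (\<zeta> \<epsilon> t - z - (t * \<epsilon> ^ m) *\<^sub>R g m z))
                \<le> norm (\<zeta> \<epsilon> t - z - (t * \<epsilon> ^ m) *\<^sub>R g m z) * B"
              using B 2 by blast
            also have "\<dots> \<le> C * \<epsilon> ^ Suc m * B"
              using elim t \<open>B > 0\<close> by (intro mult_right_mono C2) auto
            finally have "norm (g' m (\<zeta> \<epsilon> t - z - (t * \<epsilon> ^ m) *\<^sub>R g m z)) \<le> C * \<epsilon> ^ Suc m * B" .
            then have "\<epsilon> ^ m * norm (g' m (\<zeta> \<epsilon> t - z - (t * \<epsilon> ^ m) *\<^sub>R g m z))
                \<le> \<epsilon> ^ m * (C * \<epsilon> ^ Suc m * B)"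
              using elim by (intro mult_left_mono) auto
            then show "norm (\<epsilon> ^ m *\<^sub>R (- g' m (\<zeta> \<epsilon> t - z - (t * \<epsilon> ^ m) *\<^sub>R g m z)))
                \<le> C * B * \<epsilon> ^ (2 * m + 1)"
              using elim by (simp add: power_add mult_2 mult_2_right mult_ac)
          qed
        qed
      qed simp
      ultimately show ?thesis unfolding split by (rule uniform_little_o_add)
    next
      case 3
      obtain \<delta> where "\<delta> > 0" and \<delta>: "\<And>y. norm (y - z) < \<delta> \<Longrightarrow>
          norm (g i y - g i z - g' i (y - z)) \<le> 1 * norm (y - z)"
        using g'[OF i] unfolding has_derivative_at_alt by (meson zero_less_one)
      show ?thesis
      proof (rule uniform_little_o_higher_power[where C = "(B + 1) * C" and M = "2 * m + 1"])
        show "\<forall>\<^sub>F \<epsilon> in at_right 0. \<forall>t\<in>{0..T}. norm (a i \<epsilon> t) \<le> (B + 1) * C * \<epsilon> ^ (2 * m + 1)"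
          using near[OF \<open>\<delta> > 0\<close>] unit
        proof eventually_elim
          case (elim \<epsilon>)
          show ?case
          proof
            fix t assume t: "t \<in> {0..T}"
            define d where "d = \<zeta> \<epsilon> t - z"
            have "norm (g i (\<zeta> \<epsilon> t) - g i z) \<le> norm (g i (\<zeta> \<epsilon> t) - g i z - g' i d) + norm (g' i d)"
              using norm_triangle_sub by (metis add.commute)
            also have "\<dots> \<le> 1 * norm d + norm d * B"
              unfolding d_def using elim t by (intro add_mono \<delta> B) auto
            also have "\<dots> = (B + 1) * norm d" by (simp add: algebra_simps)
            also have "\<dots> \<le> (B + 1) * (C * \<epsilon> ^ m)"
              unfolding d_def using elim t \<open>B > 0\<close> by (intro mult_left_mono C1) auto
            finally have le: "norm (g i z - g i (\<zeta> \<epsilon> t)) \<le> (B + 1) * (C * \<epsilon> ^ m)"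
              by (simp add: norm_minus_commute)
            have "norm (a i \<epsilon> t) = \<epsilon> ^ i * norm (g i z - g i (\<zeta> \<epsilon> t))"
              using elim 3 by (simp add: a_def)
            also have "\<dots> \<le> \<epsilon> ^ Suc m * ((B + 1) * (C * \<epsilon> ^ m))"
              using le elim 3 by (intro mult_mono power_decreasing) auto
            also have "\<dots> = (B + 1) * C * \<epsilon> ^ (2 * m + 1)"
              by (simp add: power_add mult_2 mult_2_right mult_ac)
            finally show "norm (a i \<epsilon> t) \<le> (B + 1) * C * \<epsilon> ^ (2 * m + 1)" .
          qed
        qed
      qed simp
    qed
  qed
  then have "uniform_little_o T (2 * m) (\<lambda>\<epsilon> t. \<Sum>i=1..k. a i \<epsilon> t)"
    by (intro uniform_little_o_sum) auto
  moreover have "(\<Sum>i=1..k. a i \<epsilon> t) = (\<Sum>i=1..k. \<epsilon> ^ i *\<^sub>R g i z)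
       + (\<epsilon> ^ (2 * m) * t) *\<^sub>R g' m (g m z) - (\<Sum>i=1..k. \<epsilon> ^ i *\<^sub>R g i (\<zeta> \<epsilon> t))" for \<epsilon> t
    using \<open>1 \<le> m\<close> \<open>m \<le> k\<close>
    by (simp add: a_def sum.distrib sum_subtractf scaleR_diff_right sum.delta)
  ultimately show ?thesis unfolding \<zeta>_def g'_def by simp
qed

section \<open>Back to the original equation\<close>

text \<open>
  At each time \<open>t\<close> the curve \<open>y\<close> misses the original equation by the image of
  \<open>e = \<zeta>' - (\<Sum>i. \<epsilon>\<^bsup>i\<^esup> g\<^sub>i(\<zeta>)) - r\<close> under the spatial derivative of the change of variables.  That
  derivative is bounded on compact sets, and \<open>e\<close> is small by \<open>approx_orbit_residual\<close> and the estimate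
  of the remainder \<open>r\<close>.
\<close>

lemma transformed_orbit_nearly_solves:
  fixes z :: "'a::euclidean_space"
  assumes "0 < T" and m: "1 \<le> m" "m \<le> k" and "open D" "z \<in> D"
    and g: "stroboscopic_averaged_functions T D \<epsilon>0 k F R g"
    and zero: "\<And>i x. i \<in> {1..<m} \<Longrightarrow> x \<in> D \<Longrightarrow> g i x = 0"
    and K: "0 < \<rho>" "cball z \<rho> \<subseteq> D"
    and N: "N \<le> k" "N \<le> 2 * m"
  obtains y y' where
    "\<forall>\<^sub>F \<epsilon> in at_right 0. \<forall>t\<in>{0..T}.
       (y \<epsilon> has_vector_derivative y' \<epsilon> t) (at t) \<and> y \<epsilon> t \<in> cball z \<rho>"
    "uniform_little_o T N (\<lambda>\<epsilon> t. y' \<epsilon> t - ode_rhs k F R t (y \<epsilon> t) \<epsilon>)"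
    "\<forall>\<^sub>F \<epsilon> in at_right 0. y \<epsilon> 0 = z \<and> y \<epsilon> T = approx_orbit k g m z \<epsilon> T"
proof -
  define \<zeta> where "\<zeta> = approx_orbit k g m z"
  define \<zeta>' where "\<zeta>' \<epsilon> t = (\<Sum>i=1..k. \<epsilon> ^ i *\<^sub>R g i z)
       + (\<epsilon> ^ (2 * m) * t) *\<^sub>R frechet_derivative (g m) (at z) (g m z)" for \<epsilon> t
  obtain u r where u: "\<forall>i\<in>{1..k}. smooth_on (\<lambda>(t, z). u i t z) (UNIV \<times> D)
          \<and> (\<forall>t. \<forall>z\<in>D. u i (t + T) z = u i t z) \<and> (\<forall>z\<in>D. u i 0 z = 0)"
    and transforms: "\<forall>K. compact K \<and> K \<subseteq> D \<longrightarrow>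
         (\<exists>\<epsilon>1\<in>{0<..\<epsilon>0}. \<exists>C. \<forall>\<epsilon>\<in>{0..\<epsilon>1}. \<forall>z\<in>K.
            (\<forall>t. near_identity k u t z \<epsilon> \<in> D \<and>
               transforms_ode_at
                 (\<lambda>t z. near_identity k u t z \<epsilon>)
                 (\<lambda>t x. ode_rhs k F R t x \<epsilon>)
                 (\<lambda>t z. (\<Sum>i=1..k. \<epsilon> ^ i *\<^sub>R g i z) + r t z \<epsilon>) t z) \<and>
            (\<forall>t\<in>{0..T}. norm (r t z \<epsilon>) \<le> C * \<epsilon> ^ (k + 1)))"
    using g unfolding stroboscopic_averaged_functions_def
    by (elim conjE exE) (erule that, assumption)
  have g_smooth: "\<And>i. i \<in> {1..k} \<Longrightarrow> smooth_on (g i) D"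
    using g unfolding stroboscopic_averaged_functions_def by (elim conjE) (rule bspec)
  have u_smooth: "\<And>i. i \<in> {1..k} \<Longrightarrow> smooth_on (\<lambda>(t, z). u i t z) (UNIV \<times> D)"
    and u_per: "\<And>i t z. i \<in> {1..k} \<Longrightarrow> z \<in> D \<Longrightarrow> u i (t + T) z = u i t z"
    and u0: "\<And>i z. i \<in> {1..k} \<Longrightarrow> z \<in> D \<Longrightarrow> u i 0 z = 0"
    using u by blast+
  obtain \<epsilon>1 C where "\<epsilon>1 \<in> {0<..\<epsilon>0}" and on_ball: "\<forall>\<epsilon>\<in>{0..\<epsilon>1}. \<forall>w\<in>cball z \<rho>.
            (\<forall>t. near_identity k u t w \<epsilon> \<in> D \<and>
               transforms_ode_at
                 (\<lambda>t z. near_identity k u t z \<epsilon>)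
                 (\<lambda>t x. ode_rhs k F R t x \<epsilon>)
                 (\<lambda>t z. (\<Sum>i=1..k. \<epsilon> ^ i *\<^sub>R g i z) + r t z \<epsilon>) t w) \<and>
            (\<forall>t\<in>{0..T}. norm (r t w \<epsilon>) \<le> C * \<epsilon> ^ (k + 1))"
    using transforms[rule_format, OF conjI[OF compact_cball K(2)]] by (elim bexE exE) (rule that)
  then have "0 < \<epsilon>1" by simp
  have tr: "\<And>\<epsilon> t w. \<epsilon> \<in> {0..\<epsilon>1} \<Longrightarrow> w \<in> cball z \<rho> \<Longrightarrow>
         transforms_ode_at (\<lambda>t z. near_identity k u t z \<epsilon>) (\<lambda>t x. ode_rhs k F R t x \<epsilon>)
           (\<lambda>t z. (\<Sum>i=1..k. \<epsilon> ^ i *\<^sub>R g i z) + r t z \<epsilon>) t w"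
    and r: "\<And>\<epsilon> t w. \<epsilon> \<in> {0..\<epsilon>1} \<Longrightarrow> w \<in> cball z \<rho> \<Longrightarrow> t \<in> {0..T} \<Longrightarrow>
         norm (r t w \<epsilon>) \<le> C * \<epsilon> ^ (k + 1)"
    using on_ball by blast+
  define Q where "Q = {0..T} \<times> cball z \<rho>"
  have Q: "compact Q" "Q \<subseteq> UNIV \<times> D" and openD: "open (UNIV \<times> D :: (real \<times> 'a) set)"
    using K \<open>open D\<close> by (auto simp: Q_def intro!: compact_Times open_Times)
  have "\<forall>i\<in>{1..k}. \<exists>u'. (\<forall>p\<in>UNIV \<times> D. ((\<lambda>(t, z). u i t z) has_derivative u' p) (at p)) \<and>
      (\<exists>B. \<forall>p\<in>Q. \<forall>v. norm (u' p v) \<le> B * norm v)"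
    using smooth_on_bounded_derivative[OF u_smooth openD Q] by metis
  then obtain u' where u': "\<And>i p. i \<in> {1..k} \<Longrightarrow> p \<in> UNIV \<times> D \<Longrightarrow>
        ((\<lambda>(t, z). u i t z) has_derivative u' i p) (at p)"
    and u'_bounded: "\<And>i. i \<in> {1..k} \<Longrightarrow> \<exists>B. \<forall>p\<in>Q. \<forall>v. norm (u' i p v) \<le> B * norm v"
    by metis
  from u'_bounded obtain B where "0 \<le> B"
    and B: "\<And>i. i \<in> {1..k} \<Longrightarrow> \<forall>p\<in>Q. \<forall>v. norm (u' i p v) \<le> B * norm v"
  proof (rule finite_common_bound[OF finite_atLeastAtMost])
    show "\<forall>p\<in>Q. \<forall>v. norm (u' i p v) \<le> B' * norm v"
      if "\<forall>p\<in>Q. \<forall>v. norm (u' i p v) \<le> B * norm v" "B \<le> B'" for i B B'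
      using that mult_right_mono[OF that(2) norm_ge_zero] by (meson order_trans)
  qed auto
  have "\<exists>A. \<forall>p\<in>Q. norm ((\<lambda>(t, z). u i t z) p) \<le> A" if "i \<in> {1..k}" for i
    using continuous_on_compact_norm_bound[OF smooth_on_imp_continuous_on[OF u_smooth[OF that]] Q]
    by metis
  then obtain A where "0 \<le> A"
    and A: "\<And>i. i \<in> {1..k} \<Longrightarrow> \<forall>p\<in>Q. norm ((\<lambda>(t, z). u i t z) p) \<le> A"
    by (rule finite_common_bound[OF finite_atLeastAtMost]) force+
  define e where "e \<epsilon> t = \<zeta>' \<epsilon> t - ((\<Sum>i=1..k. \<epsilon> ^ i *\<^sub>R g i (\<zeta> \<epsilon> t)) + r t (\<zeta> \<epsilon> t) \<epsilon>)" for \<epsilon> t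
  define c where "c \<epsilon> t = e \<epsilon> t + (\<Sum>i=1..k. \<epsilon> ^ i *\<^sub>R u' i (t, \<zeta> \<epsilon> t) (0, e \<epsilon> t))" for \<epsilon> t
  define y where "y \<epsilon> t = near_identity k u t (\<zeta> \<epsilon> t) \<epsilon>" for \<epsilon> t
  define y' where "y' \<epsilon> t = ode_rhs k F R t (y \<epsilon> t) \<epsilon> + c \<epsilon> t" for \<epsilon> t
  have unit: "\<forall>\<^sub>F \<epsilon>::real in at_right 0. 0 < \<epsilon> \<and> \<epsilon> \<le> 1"
    by (rule eventually_at_right_0_in_interval) simp
  have small: "\<forall>\<^sub>F \<epsilon>::real in at_right 0. 0 < \<epsilon> \<and> \<epsilon> \<le> \<epsilon>1"
    by (rule eventually_at_right_0_in_interval) fact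
  have near: "\<forall>\<^sub>F \<epsilon> in at_right 0. \<forall>t\<in>{0..T}. norm (\<zeta> \<epsilon> t - z) < \<rho> / 2"
    unfolding \<zeta>_def using assms by (intro eventually_approx_orbit_near) auto
  have residual: "uniform_little_o T N e"
  proof -
    have "uniform_little_o T N (\<lambda>\<epsilon> t. \<zeta>' \<epsilon> t - (\<Sum>i=1..k. \<epsilon> ^ i *\<^sub>R g i (\<zeta> \<epsilon> t)))"
      unfolding \<zeta>_def \<zeta>'_def
      using assms by (intro uniform_little_o_mono[OF approx_orbit_residual N(2)]
          smooth_on_differentiable[OF g_smooth]) auto
    moreover have "uniform_little_o T N (\<lambda>\<epsilon> t. - r t (\<zeta> \<epsilon> t) \<epsilon>)"
    proof (rule uniform_little_o_higher_power)
      show "\<forall>\<^sub>F \<epsilon> in at_right 0. \<forall>t\<in>{0..T}. norm (- r t (\<zeta> \<epsilon> t) \<epsilon>) \<le> C * \<epsilon> ^ (k + 1)"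
        using small near
      proof eventually_elim
        case (elim \<epsilon>)
        show ?case
        proof
          fix t assume t: "t \<in> {0..T}"
          then have "norm (\<zeta> \<epsilon> t - z) < \<rho> / 2" using elim by blast
          then have "\<zeta> \<epsilon> t \<in> cball z \<rho>" using K(1) by (simp add: dist_norm norm_minus_commute)
          then show "norm (- r t (\<zeta> \<epsilon> t) \<epsilon>) \<le> C * \<epsilon> ^ (k + 1)" using r elim t by simp
        qed
      qed
    qed (use N in simp)
    ultimately have "uniform_little_o T N
        (\<lambda>\<epsilon> t. \<zeta>' \<epsilon> t - (\<Sum>i=1..k. \<epsilon> ^ i *\<^sub>R g i (\<zeta> \<epsilon> t)) + - r t (\<zeta> \<epsilon> t) \<epsilon>)"
      by (rule uniform_little_o_add)
    then show ?thesis unfolding e_def[abs_def] by (simp add: algebra_simps)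
  qed
  have c: "uniform_little_o T N c"
  proof (rule uniform_little_o_bound[OF residual])
    show "\<forall>\<^sub>F \<epsilon> in at_right 0. \<forall>t\<in>{0..T}. norm (c \<epsilon> t) \<le> (1 + real k * B) * norm (e \<epsilon> t)"
      using unit near
    proof eventually_elim
      case (elim \<epsilon>)
      show ?case
      proof
        fix t assume t: "t \<in> {0..T}"
        then have "norm (\<zeta> \<epsilon> t - z) < \<rho> / 2" using elim by blast
        then have "(t, \<zeta> \<epsilon> t) \<in> Q"
          using K(1) t by (simp add: Q_def dist_norm norm_minus_commute)
        then have "norm (u' i (t, \<zeta> \<epsilon> t) (0, e \<epsilon> t)) \<le> B * norm (e \<epsilon> t)" if "i \<in> {1..k}" for i
          using B[OF that, rule_format, of "(t, \<zeta> \<epsilon> t)" "(0, e \<epsilon> t)"] by (simp add: norm_Pair)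
        then have "norm (\<Sum>i=1..k. \<epsilon> ^ i *\<^sub>R u' i (t, \<zeta> \<epsilon> t) (0, e \<epsilon> t))
            \<le> \<epsilon> ^ 0 * (\<Sum>i=1..k. B * norm (e \<epsilon> t))"
          using elim by (intro norm_power_sum_le) auto
        then show "norm (c \<epsilon> t) \<le> (1 + real k * B) * norm (e \<epsilon> t)"
          unfolding c_def
          by (intro order_trans[OF norm_triangle_ineq]) (simp add: algebra_simps)
      qed
    qed
  qed
  show ?thesis
  proof (rule that[of y y'])
    show "uniform_little_o T N (\<lambda>\<epsilon> t. y' \<epsilon> t - ode_rhs k F R t (y \<epsilon> t) \<epsilon>)"
      unfolding y'_def using c by simp
    show "\<forall>\<^sub>F \<epsilon> in at_right 0. y \<epsilon> 0 = z \<and> y \<epsilon> T = approx_orbit k g m z \<epsilon> T"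
      using near
    proof eventually_elim
      case (elim \<epsilon>)
      have "norm (\<zeta> \<epsilon> T - z) < \<rho> / 2" using elim \<open>0 < T\<close> by simp
      then have "\<zeta> \<epsilon> T \<in> cball z \<rho>" using K(1) by (simp add: dist_norm norm_minus_commute)
      then have "\<zeta> \<epsilon> T \<in> D" using K(2) by blast
      then have "u i T (\<zeta> \<epsilon> T) = 0" if "i \<in> {1..k}" for i
        using u0[OF that] u_per[OF that, of _ 0] by simp
      then have "y \<epsilon> T = \<zeta> \<epsilon> T" by (simp add: y_def near_identity_def)
      moreover have "\<zeta> \<epsilon> 0 = z" by (simp add: \<zeta>_def approx_orbit_def)
      then have "y \<epsilon> 0 = z" using u0 \<open>z \<in> D\<close> by (simp add: y_def near_identity_def)
      ultimately show ?case by (simp add: \<zeta>_def)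
    qed
    have "min 1 (\<rho> / (2 * (real k * A + 1))) > 0"
      using K(1) \<open>0 \<le> A\<close> by (simp add: add_nonneg_pos)
    from eventually_at_right_0_in_interval[OF this] small near
    show "\<forall>\<^sub>F \<epsilon> in at_right 0. \<forall>t\<in>{0..T}.
       (y \<epsilon> has_vector_derivative y' \<epsilon> t) (at t) \<and> y \<epsilon> t \<in> cball z \<rho>"
    proof eventually_elim
      case (elim \<epsilon>)
      show ?case
      proof
        fix t assume t: "t \<in> {0..T}"
        have close: "norm (\<zeta> \<epsilon> t - z) < \<rho> / 2" using elim t by blast
        then have \<zeta>K: "\<zeta> \<epsilon> t \<in> cball z \<rho>"
          using K(1) by (simp add: dist_norm norm_minus_commute)
        then have \<zeta>Q: "(t, \<zeta> \<epsilon> t) \<in> Q" and \<zeta>D: "\<zeta> \<epsilon> t \<in> D" using t K(2) by (auto simp: Q_def)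
        let ?U' = "\<lambda>p. snd p + (\<Sum>i=1..k. \<epsilon> ^ i *\<^sub>R u' i (t, \<zeta> \<epsilon> t) p)"
        have "((\<lambda>p. snd p + (\<Sum>i=1..k. \<epsilon> ^ i *\<^sub>R (\<lambda>(t, z). u i t z) p)) has_derivative ?U')
            (at (t, \<zeta> \<epsilon> t))"
          by (intro has_derivative_add has_derivative_snd has_derivative_ident has_derivative_sum
              has_derivative_scaleR_right u') (use \<zeta>D in auto)
        then have U': "((\<lambda>(s, w). near_identity k u s w \<epsilon>) has_derivative ?U') (at (t, \<zeta> \<epsilon> t))"
          by (simp add: near_identity_def case_prod_unfold)
        have d\<zeta>: "(\<zeta> \<epsilon> has_vector_derivative \<zeta>' \<epsilon> t) (at t)"
          unfolding \<zeta>_def \<zeta>'_def by (rule approx_orbit_has_vector_derivative)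
        have "(y \<epsilon> has_vector_derivative y' \<epsilon> t) (at t)"
          using transforms_ode_at_residual[OF tr[of \<epsilon>, OF _ \<zeta>K] U' d\<zeta> refl] elim
          by (simp add: y'_def y_def[abs_def] c_def e_def)
        moreover have "norm (y \<epsilon> t - z) \<le> \<rho>"
        proof -
          have "norm (u i t (\<zeta> \<epsilon> t)) \<le> A" if "i \<in> {1..k}" for i
            using bspec[OF A[OF that] \<zeta>Q] by simp
          then have "norm (\<Sum>i=1..k. \<epsilon> ^ i *\<^sub>R u i t (\<zeta> \<epsilon> t)) \<le> \<epsilon> ^ 1 * (\<Sum>i=1..k. A)"
            using elim by (intro norm_power_sum_le) auto
          also have "\<dots> \<le> \<epsilon> * (real k * A + 1)" using elim by simp
          also have "\<dots> \<le> \<rho> / 2"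
          proof -
            have "\<epsilon> \<le> \<rho> / (2 * (real k * A + 1))" using elim by simp
            moreover have "0 < 2 * (real k * A + 1)" using \<open>0 \<le> A\<close> by (simp add: add_nonneg_pos)
            ultimately have "\<epsilon> * (2 * (real k * A + 1)) \<le> \<rho>" by (simp only: pos_le_divide_eq)
            then show ?thesis by linarith
          qed
          finally have "norm (\<Sum>i=1..k. \<epsilon> ^ i *\<^sub>R u i t (\<zeta> \<epsilon> t)) \<le> \<rho> / 2" .
          moreover have "y \<epsilon> t - z = (\<zeta> \<epsilon> t - z) + (\<Sum>i=1..k. \<epsilon> ^ i *\<^sub>R u i t (\<zeta> \<epsilon> t))"
            by (simp add: y_def near_identity_def)
          ultimately show ?thesis using close norm_triangle_ineq
            by (smt (verit, ccfv_threshold) field_sum_of_halves)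
        qed
        ultimately show "(y \<epsilon> has_vector_derivative y' \<epsilon> t) (at t) \<and> y \<epsilon> t \<in> cball z \<rho>"
          by (simp add: dist_norm norm_minus_commute)
      qed
    qed
  qed
qed

text \<open>
  Both curves are treated as near-solutions of the truncated field \<open>(\<Sum>i. \<epsilon>\<^bsup>i\<^esup> F\<^sub>i)\<close>, whose
  defect absorbs \<open>\<epsilon>\<^bsup>k+1\<^esup> R = O(\<epsilon>\<^bsup>k+1\<^esup>)\<close>.  The truncated field is \<open>O(\<epsilon>)\<close> together with its Lipschitz
  constant, hence for small \<open>\<epsilon>\<close> the true solution cannot leave the ball before time \<open>T\<close> and
  \<open>nearly_solutions_close\<close> applies.
\<close>

lemma ode_near_solution_shadows:
  fixes z :: "'a::euclidean_space"
  assumes "0 < T" "open D" "0 < \<epsilon>0"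
    and F_smooth: "\<And>i. i \<in> {1..k} \<Longrightarrow> smooth_on (\<lambda>(t, x). F i t x) (UNIV \<times> D)"
    and R_cont: "continuous_on (UNIV \<times> D \<times> {0..\<epsilon>0}) (\<lambda>(t, x, \<epsilon>). R t x \<epsilon>)"
    and K: "0 < \<rho>" "cball z \<rho> \<subseteq> D" and "N \<le> k"
    and x: "\<forall>\<^sub>F \<epsilon> in at_right 0. ode_solution (\<lambda>t x. ode_rhs k F R t x \<epsilon>) D T z (x \<epsilon>)"
    and y: "\<forall>\<^sub>F \<epsilon> in at_right 0. \<forall>t\<in>{0..T}.
       (y \<epsilon> has_vector_derivative y' \<epsilon> t) (at t) \<and> y \<epsilon> t \<in> cball z \<rho>"
    and y': "uniform_little_o T N (\<lambda>\<epsilon> t. y' \<epsilon> t - ode_rhs k F R t (y \<epsilon> t) \<epsilon>)"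
    and y0: "\<forall>\<^sub>F \<epsilon> in at_right 0. y \<epsilon> 0 = z"
  shows "uniform_little_o T N (\<lambda>\<epsilon> t. x \<epsilon> T - y \<epsilon> T)"
proof -
  define Q where "Q = {0..T} \<times> cball z \<rho>"
  have Q: "compact Q" "convex Q" "Q \<subseteq> UNIV \<times> D"
    and openD: "open (UNIV \<times> D :: (real \<times> 'a) set)"
    using K \<open>open D\<close> by (auto simp: Q_def intro!: compact_Times open_Times convex_Times)
  have "\<exists>L. \<forall>p\<in>Q. \<forall>q\<in>Q. norm ((\<lambda>(t, x). F i t x) p - (\<lambda>(t, x). F i t x) q) \<le> L * norm (p - q)"
    if "i \<in> {1..k}" for i
    using smooth_on_lipschitz_on_compact_convex[OF F_smooth[OF that] openD Q] by metis
  then obtain L where "0 \<le> L" and L: "\<And>i. i \<in> {1..k} \<Longrightarrow>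
      \<forall>p\<in>Q. \<forall>q\<in>Q. norm ((\<lambda>(t, x). F i t x) p - (\<lambda>(t, x). F i t x) q) \<le> L * norm (p - q)"
  proof (rule finite_common_bound[OF finite_atLeastAtMost])
    show "\<forall>p\<in>Q. \<forall>q\<in>Q. norm ((\<lambda>(t, x). F i t x) p - (\<lambda>(t, x). F i t x) q) \<le> L' * norm (p - q)"
      if "\<forall>p\<in>Q. \<forall>q\<in>Q. norm ((\<lambda>(t, x). F i t x) p - (\<lambda>(t, x). F i t x) q) \<le> L * norm (p - q)"
        "L \<le> L'" for i L L'
      using that(1) mult_right_mono[OF that(2) norm_ge_zero] by (meson order_trans)
  qed auto
  have "\<exists>A. \<forall>p\<in>Q. norm ((\<lambda>(t, x). F i t x) p) \<le> A" if "i \<in> {1..k}" for i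
    using continuous_on_compact_norm_bound[OF smooth_on_imp_continuous_on[OF F_smooth[OF that]] Q(1,3)]
    by metis
  then obtain A where "0 \<le> A"
    and A: "\<And>i. i \<in> {1..k} \<Longrightarrow> \<forall>p\<in>Q. norm ((\<lambda>(t, x). F i t x) p) \<le> A"
    by (rule finite_common_bound[OF finite_atLeastAtMost]) force+
  obtain B where "0 \<le> B"
    and "\<And>p. p \<in> {0..T} \<times> cball z \<rho> \<times> {0..\<epsilon>0} \<Longrightarrow> norm ((\<lambda>(t, x, \<epsilon>). R t x \<epsilon>) p) \<le> B"
    using continuous_on_compact_norm_bound[OF R_cont, of "{0..T} \<times> cball z \<rho> \<times> {0..\<epsilon>0}"] K(2)
    by (metis Sigma_mono compact_Icc compact_Times compact_cball order_refl subset_UNIV)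
  then have B: "norm (R t w \<epsilon>) \<le> B"
    if "t \<in> {0..T}" "w \<in> cball z \<rho>" "\<epsilon> \<in> {0..\<epsilon>0}" for t w \<epsilon>
    using that by force
  define X where "X \<epsilon> t w = (\<Sum>i=1..k. \<epsilon> ^ i *\<^sub>R F i t w)" for \<epsilon> t w
  have rhs: "norm (ode_rhs k F R t w \<epsilon> - X \<epsilon> t w) \<le> B * \<epsilon> ^ (k + 1)"
    if "t \<in> {0..T}" "w \<in> cball z \<rho>" "\<epsilon> \<in> {0..\<epsilon>0}" for t w \<epsilon>
  proof -
    have "norm (ode_rhs k F R t w \<epsilon> - X \<epsilon> t w) = \<epsilon> ^ (k + 1) * norm (R t w \<epsilon>)"
      using that by (simp add: ode_rhs_def X_def)
    also have "\<dots> \<le> \<epsilon> ^ (k + 1) * B" using B that by (intro mult_left_mono) auto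
    finally show ?thesis by (simp add: mult.commute)
  qed
  show ?thesis
    unfolding uniform_little_o_def
  proof (intro allI impI)
    fix \<eta> :: real assume "0 < \<eta>"
    define \<eta>' where "\<eta>' = \<eta> / (4 * T)"
    have "0 < \<eta>'" using \<open>0 < \<eta>\<close> \<open>0 < T\<close> by (simp add: \<eta>'_def)
    \<comment> \<open>In this order: powers of \<open>\<epsilon>\<close> decrease for \<open>\<epsilon> \<le> 1\<close>, \<open>R\<close> needs \<open>\<epsilon> \<le> \<epsilon>0\<close>, absorption needs
      \<open>T * (\<epsilon> * (k * L)) \<le> 1/2\<close>, confinement needs \<open>T * (\<epsilon> * (k * A + B)) < \<rho>\<close>, and the contribution
      of \<open>R\<close> to the final error must be at most half of \<open>\<eta> * \<epsilon> ^ N\<close>.\<close>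
    define b where "b = Min {1, \<epsilon>0, 1 / (2 * (T * (real k * L) + 1)),
        \<rho> / (2 * (T * (real k * A + B) + 1)), \<eta> / (8 * T * (B + 1))}"
    have pos: "0 < T * (real k * L) + 1" "0 < T * (real k * A + B) + 1" "0 < 8 * T * (B + 1)"
      using \<open>0 < T\<close> \<open>0 \<le> L\<close> \<open>0 \<le> A\<close> \<open>0 \<le> B\<close> by (auto intro!: add_nonneg_pos)
    then have "0 < b" using \<open>0 < \<eta>\<close> \<open>0 < \<epsilon>0\<close> K(1) by (simp add: b_def)
    have b: "b \<le> 1" "b \<le> \<epsilon>0" "b \<le> 1 / (2 * (T * (real k * L) + 1))"
      "b \<le> \<rho> / (2 * (T * (real k * A + B) + 1))" "b \<le> \<eta> / (8 * T * (B + 1))"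
      unfolding b_def by (rule Min_le; simp)+
    from eventually_at_right_0_in_interval[OF \<open>0 < b\<close>] x y y0 uniform_little_oD[OF y' \<open>0 < \<eta>'\<close>]
    show "\<forall>\<^sub>F \<epsilon> in at_right 0. \<forall>t\<in>{0..T}. norm (x \<epsilon> T - y \<epsilon> T) \<le> \<eta> * \<epsilon> ^ N"
    proof eventually_elim
      case (elim \<epsilon>)
      have \<epsilon>: "0 < \<epsilon>" "\<epsilon> \<le> 1" "\<epsilon> \<in> {0..\<epsilon>0}" using elim(1) b by auto
      have scale: "\<epsilon> * c \<le> d" if "b \<le> d / c" "0 < c" for c d
        using elim(1) that by (metis order_trans pos_le_divide_eq)
      have \<epsilon>L: "\<epsilon> * (2 * (T * (real k * L) + 1)) \<le> 1"
        using b(3) pos by (intro scale) auto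
      have \<epsilon>A: "\<epsilon> * (2 * (T * (real k * A + B) + 1)) \<le> \<rho>"
        using b(4) pos by (intro scale) auto
      have \<epsilon>B: "\<epsilon> * (8 * T * (B + 1)) \<le> \<eta>"
        using b(5) pos by (intro scale) auto
      have x0: "x \<epsilon> 0 = z" and dx: "\<And>t. t \<in> {0..T} \<Longrightarrow>
          (x \<epsilon> has_vector_derivative ode_rhs k F R t (x \<epsilon> t) \<epsilon>) (at t within {0..T})"
        using elim(2) unfolding ode_solution_def by auto
      have speed: "norm (ode_rhs k F R t w \<epsilon>) \<le> \<epsilon> * (real k * A + B)"
        if t: "t \<in> {0..T}" and w: "w \<in> cball z \<rho>" for t w
      proof -
        have "norm (ode_rhs k F R t w \<epsilon>) \<le> norm (X \<epsilon> t w) + norm (ode_rhs k F R t w \<epsilon> - X \<epsilon> t w)"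
          by (rule norm_triangle_sub)
        also have "norm (X \<epsilon> t w) \<le> \<epsilon> ^ 1 * (\<Sum>i=1..k. A)"
          unfolding X_def using A \<epsilon> t w by (intro norm_power_sum_le) (auto simp: Q_def)
        also have "norm (ode_rhs k F R t w \<epsilon> - X \<epsilon> t w) \<le> B * \<epsilon> ^ (k + 1)"
          using rhs t w \<epsilon> by blast
        also have "\<dots> \<le> B * \<epsilon> ^ 1"
          using \<epsilon> \<open>0 \<le> B\<close> by (intro mult_left_mono power_decreasing) auto
        finally show ?thesis by (simp add: algebra_simps)
      qed
      have xK: "x \<epsilon> t \<in> cball z \<rho>" if "t \<in> {0..T}" for t
      proof (rule slow_curve_stays_in_cball[OF dx x0 speed _ _ that])
        show "T * (\<epsilon> * (real k * A + B)) < \<rho>"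
          using \<epsilon>A \<epsilon>(1) \<open>0 < T\<close> \<open>0 \<le> A\<close> \<open>0 \<le> B\<close> K(1)
            mult_nonneg_nonneg[of \<epsilon> "T * (real k * A + B)"]
          by (simp add: algebra_simps)
      qed (use \<epsilon> \<open>0 \<le> A\<close> \<open>0 \<le> B\<close> in auto)
      have yK: "y \<epsilon> t \<in> cball z \<rho>" if "t \<in> {0..T}" for t using elim(3) that by blast
      have "norm (x \<epsilon> T - y \<epsilon> T) \<le> 2 * T * (B * \<epsilon> ^ (k + 1) + (\<eta>' * \<epsilon> ^ N + B * \<epsilon> ^ (k + 1)))"
      proof (rule nearly_solutions_close[where X = "X \<epsilon>" and L = "\<epsilon> * (real k * L)"
            and x' = "\<lambda>t. ode_rhs k F R t (x \<epsilon> t) \<epsilon>" and y' = "y' \<epsilon>"])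
        show "(y \<epsilon> has_vector_derivative y' \<epsilon> s) (at s within {0..T})" if "s \<in> {0..T}" for s
          using elim(3) that has_vector_derivative_at_within by blast
        show "norm (ode_rhs k F R s (x \<epsilon> s) \<epsilon> - X \<epsilon> s (x \<epsilon> s)) \<le> B * \<epsilon> ^ (k + 1)"
          if "s \<in> {0..T}" for s using rhs that xK \<epsilon> by blast
        show "norm (y' \<epsilon> s - X \<epsilon> s (y \<epsilon> s)) \<le> \<eta>' * \<epsilon> ^ N + B * \<epsilon> ^ (k + 1)"
          if s: "s \<in> {0..T}" for s
        proof -
          have "norm (y' \<epsilon> s - ode_rhs k F R s (y \<epsilon> s) \<epsilon>) \<le> \<eta>' * \<epsilon> ^ N" using elim(5) s by blast
          moreover have "norm (ode_rhs k F R s (y \<epsilon> s) \<epsilon> - X \<epsilon> s (y \<epsilon> s)) \<le> B * \<epsilon> ^ (k + 1)"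
            using rhs s yK \<epsilon> by blast
          ultimately show ?thesis by (rule norm_diff_triangle_le)
        qed
        show "norm (X \<epsilon> s (x \<epsilon> s) - X \<epsilon> s (y \<epsilon> s)) \<le> \<epsilon> * (real k * L) * norm (x \<epsilon> s - y \<epsilon> s)"
          if s: "s \<in> {0..T}" for s
        proof -
          have "norm (F i s (x \<epsilon> s) - F i s (y \<epsilon> s)) \<le> L * norm (x \<epsilon> s - y \<epsilon> s)"
            if "i \<in> {1..k}" for i
            using L[OF that, rule_format, of "(s, x \<epsilon> s)" "(s, y \<epsilon> s)"] xK[OF s] yK[OF s] s
            by (simp add: Q_def norm_Pair)
          then have "norm (\<Sum>i=1..k. \<epsilon> ^ i *\<^sub>R (F i s (x \<epsilon> s) - F i s (y \<epsilon> s)))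
              \<le> \<epsilon> ^ 1 * (\<Sum>i=1..k. L * norm (x \<epsilon> s - y \<epsilon> s))"
            using \<epsilon> by (intro norm_power_sum_le) auto
          then show ?thesis
            by (simp add: X_def sum_subtractf scaleR_diff_right mult_ac)
        qed
        show "T * (\<epsilon> * (real k * L)) \<le> 1 / 2"
          using \<epsilon>L \<epsilon>(1) by (simp add: algebra_simps)
        show "x \<epsilon> 0 = y \<epsilon> 0" using x0 elim(4) by simp
      qed (use dx \<open>0 < T\<close> \<open>0 \<le> L\<close> \<epsilon> in auto)
      also have "\<dots> = 2 * T * \<eta>' * \<epsilon> ^ N + 4 * T * B * \<epsilon> ^ (k + 1)" by (simp add: algebra_simps)
      also have "2 * T * \<eta>' * \<epsilon> ^ N = \<eta> / 2 * \<epsilon> ^ N" using \<open>0 < T\<close> by (simp add: \<eta>'_def)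
      also have "4 * T * B * \<epsilon> ^ (k + 1) \<le> 4 * T * (B + 1) * \<epsilon> ^ Suc N"
        using \<epsilon> \<open>0 < T\<close> \<open>0 \<le> B\<close> \<open>N \<le> k\<close> by (intro mult_mono power_decreasing) auto
      also have "4 * T * (B + 1) * \<epsilon> ^ Suc N = (\<epsilon> * (8 * T * (B + 1))) / 2 * \<epsilon> ^ N" by simp
      also have "\<dots> \<le> \<eta> / 2 * \<epsilon> ^ N" using \<epsilon> by (intro mult_right_mono divide_right_mono \<epsilon>B) auto
      finally have "norm (x \<epsilon> T - y \<epsilon> T) \<le> \<eta> * \<epsilon> ^ N" by simp
      then show ?case by blast
    qed
  qed
qed

text \<open>
  The expansion \<open>z + (\<Sum>i. \<epsilon>\<^bsup>i\<^esup> f\<^sub>i(z))\<close> and \<open>\<zeta>(T)\<close> both approximate the value at \<open>T\<close> of the solution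
  through \<open>z\<close> up to \<open>o(\<epsilon>\<^bsup>N\<^esup>)\<close>, so their coefficients agree up to order \<open>N\<close>.
\<close>

lemma melnikov_averaged_relation:
  fixes z :: "'a::euclidean_space"
  assumes "0 < T" "open D" "0 < \<epsilon>0" and m: "1 \<le> m" "m \<le> k"
    and F_smooth: "\<And>i. i \<in> {1..k} \<Longrightarrow> smooth_on (\<lambda>(t, x). F i t x) (UNIV \<times> D)"
    and R_cont: "continuous_on (UNIV \<times> D \<times> {0..\<epsilon>0}) (\<lambda>(t, x, \<epsilon>). R t x \<epsilon>)"
    and f: "melnikov_functions T D \<epsilon>0 k F R f"
    and g: "stroboscopic_averaged_functions T D \<epsilon>0 k F R g"
    and zero: "\<And>i x. i \<in> {1..<m} \<Longrightarrow> x \<in> D \<Longrightarrow> g i x = 0"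
    and "z \<in> D"
  shows "\<And>i. i \<in> {1..2 * m - 1} \<Longrightarrow> i \<le> k \<Longrightarrow> f i z = T *\<^sub>R g i z"
    and "2 * m \<le> k \<Longrightarrow> f (2 * m) z
      = T *\<^sub>R g (2 * m) z + (T\<^sup>2 / 2) *\<^sub>R frechet_derivative (g m) (at z) (g m z)"
proof -
  define N where "N = min k (2 * m)"
  have N: "N \<le> k" "N \<le> 2 * m" by (simp_all add: N_def)
  define h where "h = frechet_derivative (g m) (at z) (g m z)"
  obtain \<rho> where K: "0 < \<rho>" "cball z \<rho> \<subseteq> D"
    using \<open>open D\<close> \<open>z \<in> D\<close> open_contains_cball by blast
  obtain \<epsilon>1 C where "0 < \<epsilon>1"
    and sol: "\<And>\<epsilon>. \<epsilon> \<in> {0..\<epsilon>1} \<Longrightarrow> \<exists>x. ode_solution (\<lambda>t x. ode_rhs k F R t x \<epsilon>) D T z x"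
    and expansion: "\<And>\<epsilon> x. \<epsilon> \<in> {0..\<epsilon>1} \<Longrightarrow> ode_solution (\<lambda>t x. ode_rhs k F R t x \<epsilon>) D T z x \<Longrightarrow>
       norm (x T - (z + (\<Sum>i=1..k. \<epsilon> ^ i *\<^sub>R f i z))) \<le> C * \<epsilon> ^ (k + 1)"
  proof -
    have "compact {z}" "{z} \<subseteq> D" using \<open>z \<in> D\<close> by auto
    with f have "\<exists>\<epsilon>1\<in>{0<..\<epsilon>0}. \<exists>C. \<forall>\<epsilon>\<in>{0..\<epsilon>1}. \<forall>z\<in>{z}.
          (\<exists>x. ode_solution (\<lambda>t x. ode_rhs k F R t x \<epsilon>) D T z x) \<and>
          (\<forall>x. ode_solution (\<lambda>t x. ode_rhs k F R t x \<epsilon>) D T z x \<longrightarrow>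
             norm (x T - (z + (\<Sum>i=1..k. \<epsilon> ^ i *\<^sub>R f i z))) \<le> C * \<epsilon> ^ (k + 1))"
      unfolding melnikov_functions_def by blast
    then show ?thesis using that by (meson greaterThanAtMost_iff singletonI)
  qed
  define x where "x \<epsilon> = (SOME x. ode_solution (\<lambda>t x. ode_rhs k F R t x \<epsilon>) D T z x)" for \<epsilon>
  have x: "ode_solution (\<lambda>t x. ode_rhs k F R t x \<epsilon>) D T z (x \<epsilon>)" if "\<epsilon> \<in> {0..\<epsilon>1}" for \<epsilon>
    unfolding x_def using sol[OF that] by (rule someI_ex)
  have small: "\<forall>\<^sub>F \<epsilon> in at_right 0. 0 < \<epsilon> \<and> \<epsilon> \<le> \<epsilon>1"
    by (rule eventually_at_right_0_in_interval) fact
  obtain y y' where y: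
    "\<forall>\<^sub>F \<epsilon> in at_right 0. \<forall>t\<in>{0..T}.
       (y \<epsilon> has_vector_derivative y' \<epsilon> t) (at t) \<and> y \<epsilon> t \<in> cball z \<rho>"
    and y': "uniform_little_o T N (\<lambda>\<epsilon> t. y' \<epsilon> t - ode_rhs k F R t (y \<epsilon> t) \<epsilon>)"
    and ends: "\<forall>\<^sub>F \<epsilon> in at_right 0. y \<epsilon> 0 = z \<and> y \<epsilon> T = approx_orbit k g m z \<epsilon> T"
    using transformed_orbit_nearly_solves[OF \<open>0 < T\<close> m \<open>open D\<close> \<open>z \<in> D\<close> g zero K N] by blast
  have xy: "uniform_little_o T N (\<lambda>\<epsilon> t. x \<epsilon> T - y \<epsilon> T)"
  proof (rule ode_near_solution_shadows[OF \<open>0 < T\<close> \<open>open D\<close> \<open>0 < \<epsilon>0\<close> F_smooth R_cont K N(1) _ y y'])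
    show "\<forall>\<^sub>F \<epsilon> in at_right 0. ode_solution (\<lambda>t x. ode_rhs k F R t x \<epsilon>) D T z (x \<epsilon>)"
      using small by (rule eventually_mono) (use x in auto)
    show "\<forall>\<^sub>F \<epsilon> in at_right 0. y \<epsilon> 0 = z" using ends by (rule eventually_mono) simp
  qed
  have fx: "uniform_little_o T N (\<lambda>\<epsilon> t. z + (\<Sum>i=1..k. \<epsilon> ^ i *\<^sub>R f i z) - x \<epsilon> T)"
  proof (rule uniform_little_o_higher_power)
    show "\<forall>\<^sub>F \<epsilon> in at_right 0. \<forall>t\<in>{0..T}.
        norm (z + (\<Sum>i=1..k. \<epsilon> ^ i *\<^sub>R f i z) - x \<epsilon> T) \<le> C * \<epsilon> ^ (k + 1)"
      using small
      by (rule eventually_mono)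
        (use expansion[OF _ x] in \<open>auto simp: norm_minus_commute[of "z + _" "x _ T"]\<close>)
  qed (use N in simp)
  \<comment> \<open>The quadratic term sits at index \<open>2 * m\<close> even when \<open>2 * m > k\<close>; then \<open>N = k\<close> and its coefficient
    is not among those that vanish.\<close>
  define a where "a i = (if i \<in> {1..k} then f i z - T *\<^sub>R g i z else 0)
      - (if i = 2 * m then (T\<^sup>2 / 2) *\<^sub>R h else 0)" for i
  have a: "(\<Sum>i\<le>k + 2 * m. \<epsilon> ^ i *\<^sub>R a i)
      = z + (\<Sum>i=1..k. \<epsilon> ^ i *\<^sub>R f i z) - approx_orbit k g m z \<epsilon> T" for \<epsilon> :: real
  proof -
    have "(\<Sum>i\<le>k + 2 * m. \<epsilon> ^ i *\<^sub>R a i)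
        = (\<Sum>i\<le>k + 2 * m. if i \<in> {1..k} then \<epsilon> ^ i *\<^sub>R (f i z - T *\<^sub>R g i z) else 0)
          - (\<Sum>i\<le>k + 2 * m. if i = 2 * m then (\<epsilon> ^ i * (T\<^sup>2 / 2)) *\<^sub>R h else 0)"
      unfolding sum_subtractf[symmetric]
      by (rule sum.cong) (auto simp: a_def scaleR_diff_right)
    also have "(\<Sum>i\<le>k + 2 * m. if i \<in> {1..k} then \<epsilon> ^ i *\<^sub>R (f i z - T *\<^sub>R g i z) else 0)
        = (\<Sum>i=1..k. \<epsilon> ^ i *\<^sub>R (f i z - T *\<^sub>R g i z))"
      by (rule sum.mono_neutral_cong_right) auto
    also have "\<dots> = (\<Sum>i=1..k. \<epsilon> ^ i *\<^sub>R f i z) - T *\<^sub>R (\<Sum>i=1..k. \<epsilon> ^ i *\<^sub>R g i z)"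
      by (simp add: scaleR_diff_right sum_subtractf scaleR_sum_right mult.commute)
    also have "(\<Sum>i\<le>k + 2 * m. if i = 2 * m then (\<epsilon> ^ i * (T\<^sup>2 / 2)) *\<^sub>R h else 0)
        = (\<epsilon> ^ (2 * m) * T\<^sup>2 / 2) *\<^sub>R h" by simp
    finally show ?thesis by (simp add: approx_orbit_def h_def)
  qed
  have "uniform_little_o T N (\<lambda>\<epsilon> t. \<Sum>i\<le>k + 2 * m. \<epsilon> ^ i *\<^sub>R a i)"
  proof (rule uniform_little_o_bound[OF uniform_little_o_add[OF fx xy], where C = 1])
    show "\<forall>\<^sub>F \<epsilon> in at_right 0. \<forall>t\<in>{0..T}. norm (\<Sum>i\<le>k + 2 * m. \<epsilon> ^ i *\<^sub>R a i)
        \<le> 1 * norm (z + (\<Sum>i=1..k. \<epsilon> ^ i *\<^sub>R f i z) - x \<epsilon> T + (x \<epsilon> T - y \<epsilon> T))"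
      using ends by (rule eventually_mono) (simp add: a)
  qed
  then have coeff: "a i = 0" if "i \<le> N" for i
    using polynomial_coeffs_eq_0_of_little_o[of T N a "k + 2 * m" i] \<open>0 < T\<close> that N by simp
  show "f i z = T *\<^sub>R g i z" if "i \<in> {1..2 * m - 1}" "i \<le> k" for i
  proof -
    have "i \<noteq> 2 * m" "i \<le> N" using that by (auto simp: N_def)
    then show ?thesis using coeff[of i] that by (simp add: a_def)
  qed
  show "f (2 * m) z = T *\<^sub>R g (2 * m) z + (T\<^sup>2 / 2) *\<^sub>R frechet_derivative (g m) (at z) (g m z)"
    if "2 * m \<le> k"
    using coeff[of "2 * m"] that m by (simp add: a_def N_def h_def algebra_simps)
qed

theorem proposition1:
  fixes T \<epsilon>0 :: real
    and k l :: nat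
    and D :: "(real ^ 'n) set"
    and F :: "nat \<Rightarrow> real \<Rightarrow> real ^ 'n \<Rightarrow> real ^ 'n"
    and R :: "real \<Rightarrow> real ^ 'n \<Rightarrow> real \<Rightarrow> real ^ 'n"
    and f g :: "nat \<Rightarrow> real ^ 'n \<Rightarrow> real ^ 'n"
  assumes "T > 0" and "k \<ge> 2" and "open D" and "bounded D" and "\<epsilon>0 > 0"
    and F_smooth: "\<And>i. i \<in> {1..k} \<Longrightarrow> smooth_on (\<lambda>(t, x). F i t x) (UNIV \<times> D)"
    and F_periodic: "\<And>i t x. i \<in> {1..k} \<Longrightarrow> x \<in> D \<Longrightarrow> F i (t + T) x = F i t x"
    and R_smooth: "smooth_on (\<lambda>(t, x, \<epsilon>). R t x \<epsilon>) (UNIV \<times> D \<times> {0..\<epsilon>0})"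
    and R_periodic: "\<And>t x \<epsilon>. x \<in> D \<Longrightarrow> \<epsilon> \<in> {0..\<epsilon>0} \<Longrightarrow> R (t + T) x \<epsilon> = R t x \<epsilon>"
    and f: "melnikov_functions T D \<epsilon>0 k F R f"
    and g: "stroboscopic_averaged_functions T D \<epsilon>0 k F R g"
    and l: "l \<in> {2..k}"
    and vanish: "(\<forall>i\<in>{1..l - 1}. \<forall>z\<in>D. f i z = 0) \<or> (\<forall>i\<in>{1..l - 1}. \<forall>z\<in>D. g i z = 0)"
  shows "(\<forall>i\<in>{1..2 * l - 1}. i \<le> k \<longrightarrow> (\<forall>z\<in>D. f i z = T *\<^sub>R g i z)) \<and>
         (2 * l \<le> k \<longrightarrow> (\<forall>z\<in>D.
           f l differentiable (at z) \<and>
           g (2 * l) z =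
             (1 / T) *\<^sub>R (f (2 * l) z - (1 / 2) *\<^sub>R frechet_derivative (f l) (at z) (f l z)))) \<and>
         (2 * l \<le> k \<longrightarrow> (\<forall>z\<in>D.
           g l differentiable (at z) \<and>
           f (2 * l) z =
             T *\<^sub>R g (2 * l) z + (T\<^sup>2 / 2) *\<^sub>R frechet_derivative (g l) (at z) (g l z)))"
proof -
  have R_cont: "continuous_on (UNIV \<times> D \<times> {0..\<epsilon>0}) (\<lambda>(t, x, \<epsilon>). R t x \<epsilon>)"
    using R_smooth by (rule smooth_on_imp_continuous_on)
  note relation = melnikov_averaged_relation[OF \<open>T > 0\<close> \<open>open D\<close> \<open>\<epsilon>0 > 0\<close> _ _ F_smooth R_cont f g]
  have g_zero: "g i z = 0" if "i \<in> {1..<l}" "z \<in> D" for i z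
  proof (cases "\<forall>i\<in>{1..l - 1}. \<forall>z\<in>D. g i z = 0")
    case True
    then show ?thesis using that by auto
  next
    case False
    then have f_zero: "f i z = 0" if "i \<in> {1..<l}" "z \<in> D" for i z using vanish that by auto
    show ?thesis using that
    proof (induction i arbitrary: z rule: less_induct)
      case (less i)
      have "f i z = T *\<^sub>R g i z"
        using less l by (intro relation(1)[of i z i]) auto
      then show ?case using f_zero[OF less.prems] \<open>T > 0\<close> by simp
    qed
  qed
  have low: "f i z = T *\<^sub>R g i z" if "i \<in> {1..2 * l - 1}" "i \<le> k" "z \<in> D" for i z
    using that l g_zero by (intro relation(1)[of l]) auto
  have high: "f (2 * l) z
      = T *\<^sub>R g (2 * l) z + (T\<^sup>2 / 2) *\<^sub>R frechet_derivative (g l) (at z) (g l z)"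
    if "2 * l \<le> k" "z \<in> D" for z
    using that l g_zero by (intro relation(2)[of l]) auto
  have fl: "f l z = T *\<^sub>R g l z" if "z \<in> D" for z using low[of l z] l that by auto
  have g_diff: "g l differentiable (at z)" if "z \<in> D" for z
    using g l that \<open>open D\<close> unfolding stroboscopic_averaged_functions_def
    by (intro smooth_on_differentiable[of _ D]) auto
  have f_der: "(f l has_derivative (\<lambda>v. T *\<^sub>R frechet_derivative (g l) (at z) v)) (at z)"
    if "z \<in> D" for z
  proof (rule has_derivative_transform_within_open[OF _ \<open>open D\<close> that])
    show "((\<lambda>x. T *\<^sub>R g l x) has_derivative (\<lambda>v. T *\<^sub>R frechet_derivative (g l) (at z) v)) (at z)"
      using g_diff[OF that] by (intro has_derivative_scaleR_right) (simp add: frechet_derivative_works)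
  qed (simp add: fl)
  have square: "frechet_derivative (f l) (at z) (f l z)
      = T\<^sup>2 *\<^sub>R frechet_derivative (g l) (at z) (g l z)" if "z \<in> D" for z
  proof -
    have "linear (frechet_derivative (g l) (at z))"
      using g_diff[OF that] by (rule linear_frechet_derivative)
    then show ?thesis
      using frechet_derivative_at[OF f_der[OF that], symmetric] fl[OF that]
      by (simp add: linear_cmul power2_eq_square)
  qed
  have f_diff: "f l differentiable (at z)" if "z \<in> D" for z
    using f_der[OF that] by (auto simp: differentiable_def)
  show ?thesis
    using low high f_diff g_diff square \<open>T > 0\<close> by simp
qed

end
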